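(* Let $P\in[0,1]^{k\times k}$ be symmetric with column sums $c_1\le\cdots\le c_k$, let $G$ be the $t^{\text{th}}$-order stochastic Kronecker graph generated by $P$, and suppose $W$ is connected and non-bipartite. Fix $\epsilon,\nu>0$. Let $\lambda$ be the spectral gap of $W$ and let $s=\left\lceil \frac1\lambda \ln\!\left(\frac{2\,\mathrm{vol}(W)}{c_1\epsilon}\right)\right\rceil$. Then for $t$ sufficiently large, any vertex $v\in\Sigma_\nu$ is connected to $\mathcal{S}_\epsilon$ by a path in $G$ of length at most $s$ with probability at least $1-s\,e^{-e^{\nu t-\Theta(\sqrt t)}}$.
   Context: The $t^{\text{th}}$-order stochastic Kronecker graph generated by a symmetric $P\in[0,1]^{k\times k}$ has vertex set $[k]^t$, each pair $\{u,v\}$ being an edge independently with probability $\prod_{i=1}^t P_{u_iv_i}$. $W$ is the weighted graph on $[k]$ with edge weights $P_{ij}$ (edges where $P_{ij}>0$, loops allowed); $c_j=\sum_iP_{ij}$, $\mathrm{vol}(W)=\sum_jc_j$, $C=\mathrm{diag}(c_1,\dots,c_k)$, $M=C^{-1}P$ is the transition matrix of the random walk on $W$, and $\pi_i=c_i/\mathrm{vol}(W)$. The spectral gap of $W$ is $\min(\lambda_1, 2-\lambda_{k-1})$ where $0=\lambda_0\le\lambda_1\le\dots\le\lambda_{k-1}$ are the eigenvalues of $I-C^{-1/2}PC^{-1/2}$. The signature of $v=(v_1,\dots,v_t)$ is the row vector $\sigma(v)=(\sigma_1,\dots,\sigma_k)$ with $\sigma_i$ the proportion of coordinates of $v$ equal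 to $i$. $L=(\ln c_1,\dots,\ln c_k)$. $\mathcal{S}_\epsilon=\{v : \sigma_i(v)>(1-\epsilon)\pi_i \text{ for all } i\}$ and $\Sigma_\nu=\{v : \langle\sigma(v)M^s, L\rangle\ge\nu \text{ for all integers } s\ge 0\}$. Asymptotics are as $t\to\infty$. *)

theory Defs
  imports
    "HOL-Probability.Probability"
    "HOL-Library.Landau_Symbols"
    "Jordan_Normal_Form.Char_Poly"
    "Graph_Theory.Graph_Theory"
begin

text \<open>
  Indices in \<open>[k]\<close> are shifted to \<open>{0..<k}\<close>, where \<open>k\<close> is the dimension of the square matrix
  \<open>P\<close>; in particular the smallest column sum \<open>c\<^sub>1\<close> is \<open>col_sum P 0\<close>.
  Undirected graphs are digraphs with a symmetric arc relation.
\<close>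

definition weight_graph :: "real mat \<Rightarrow> nat pair_pre_digraph" where
  "weight_graph P =
     \<lparr> pverts = {0..<dim_row P},
       parcs = {(i, j). i < dim_row P \<and> j < dim_row P \<and> P $$ (i, j) > 0} \<rparr>"

definition bipartite :: "('a, 'b) pre_digraph \<Rightarrow> bool" where
  "bipartite G \<longleftrightarrow> (\<exists>A B. verts G = A \<union> B \<and> A \<inter> B = {} \<and>
     arcs_ends G \<subseteq> A \<times> B \<union> B \<times> A)"

definition col_sum :: "real mat \<Rightarrow> nat \<Rightarrow> real" where
  "col_sum P j = (\<Sum>i<dim_row P. P $$ (i, j))"

definition vol :: "real mat \<Rightarrow> real" where
  "vol P = (\<Sum>j<dim_row P. col_sum P j)"

definition walk_matrix :: "real mat \<Rightarrow> real mat" where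
  "walk_matrix P = mat_diag (dim_row P) (\<lambda>i. 1 / col_sum P i) * P"

definition stationary :: "real mat \<Rightarrow> nat \<Rightarrow> real" where
  "stationary P i = col_sum P i / vol P"

definition normalized_laplacian :: "real mat \<Rightarrow> real mat" where
  "normalized_laplacian P =
     (let D = mat_diag (dim_row P) (\<lambda>i. 1 / sqrt (col_sum P i))
      in 1\<^sub>m (dim_row P) - D * P * D)"

text \<open>Eigenvalues in increasing order, repeated according to algebraic multiplicity.\<close>

definition sorted_eigenvalues :: "real mat \<Rightarrow> real list" where
  "sorted_eigenvalues A = sorted_list_of_multiset (proots (char_poly A))"

text \<open>
  For a one-vertex graph \<open>\<lambda>\<^sub>1\<close> does not exist and the value below is unspecified.
\<close>

definition spectral_gap :: "real mat \<Rightarrow> real" where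
  "spectral_gap P =
     (let ev = sorted_eigenvalues (normalized_laplacian P)
      in min (ev ! 1) (2 - ev ! (dim_row P - 1)))"

definition kron_verts :: "nat \<Rightarrow> nat \<Rightarrow> nat list set" where
  "kron_verts k t = {v. length v = t \<and> set v \<subseteq> {0..<k}}"

definition kron_pairs :: "nat \<Rightarrow> nat \<Rightarrow> nat list set set" where
  "kron_pairs k t = {{u, v} | u v. u \<in> kron_verts k t \<and> v \<in> kron_verts k t \<and> u \<noteq> v}"

text \<open>The product depends only on the unordered pair because \<open>P\<close> is assumed symmetric.\<close>

definition pair_prob :: "real mat \<Rightarrow> nat \<Rightarrow> nat list set \<Rightarrow> real" where
  "pair_prob P t e = (THE p. \<exists>u v. e = {u, v} \<and> p = (\<Prod>i<t. P $$ (u ! i, v ! i)))"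

definition kronecker_graph :: "real mat \<Rightarrow> nat \<Rightarrow> nat list pair_pre_digraph pmf" where
  "kronecker_graph P t =
     map_pmf (\<lambda>\<omega>. \<lparr> pverts = kron_verts (dim_row P) t,
                     parcs = {(u, v). {u, v} \<in> kron_pairs (dim_row P) t \<and> \<omega> {u, v}} \<rparr>)
       (Pi_pmf (kron_pairs (dim_row P) t) False (\<lambda>e. bernoulli_pmf (pair_prob P t e)))"

definition signature :: "nat \<Rightarrow> nat list \<Rightarrow> real Matrix.vec" where
  "signature k v = Matrix.vec k (\<lambda>i. real (count_list v i) / real (length v))"

definition log_vec :: "real mat \<Rightarrow> real Matrix.vec" where
  "log_vec P = Matrix.vec (dim_row P) (\<lambda>i. ln (col_sum P i))"

definition balanced_verts :: "real mat \<Rightarrow> nat \<Rightarrow> real \<Rightarrow> nat list set" where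
  "balanced_verts P t \<epsilon> =
     {v \<in> kron_verts (dim_row P) t.
        \<forall>i<dim_row P. vec_index (signature (dim_row P) v) i > (1 - \<epsilon>) * stationary P i}"

text \<open>The row vector \<open>\<sigma>(v) M\<^sup>s\<close> is written as the transpose of \<open>M\<^sup>s\<close> applied to \<open>\<sigma>(v)\<close>.\<close>

definition expanding_verts :: "real mat \<Rightarrow> nat \<Rightarrow> real \<Rightarrow> nat list set" where
  "expanding_verts P t \<nu> =
     {v \<in> kron_verts (dim_row P) t.
        \<forall>s::nat. scalar_prod
          (transpose_mat (walk_matrix P ^\<^sub>m s) *\<^sub>v signature (dim_row P) v) (log_vec P) \<ge> \<nu>}"

definition linked_within :: "('a, 'b) pre_digraph \<Rightarrow> 'a \<Rightarrow> 'a set \<Rightarrow> nat \<Rightarrow> bool" where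
  "linked_within G v S n \<longleftrightarrow>
     (\<exists>p. vpath p G \<and> hd p = v \<and> last p \<in> S \<and> vwalk_length p \<le> n)"

end

theory Submission
  imports Defs "Jordan_Normal_Form.Schur_Decomposition" "HOL-Real_Asymp.Real_Asymp"
begin

text \<open>
  If a vertex \<open>u\<close> has signature \<open>\<sigma>\<close>, then its expected degree is \<open>exp (t \<langle>\<sigma>, L\<rangle>)\<close>, and by
  Chebyshev's inequality at least half of it goes to neighbours whose signature is within
  \<open>O(1 / sqrt t)\<close> of \<open>\<sigma> M\<close>. So \<open>u\<close> has no such neighbour with probability at most
  \<open>exp (- exp (t \<langle>\<sigma>, L\<rangle>) / 2 + 1)\<close>, a quantity that absorbs a union bound over all vertices of the
  graph. Hence, outside an event of that size, one can start at \<open>v\<close> and follow \<open>\<sigma>(v) M\<^sup>r\<close> up to an error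
  \<open>O(1 / sqrt t)\<close>, the expected degree staying at least \<open>exp (\<nu> t - O(sqrt t))\<close>. After \<open>s\<close> steps the
  spectral gap makes \<open>\<sigma>(v) M\<^sup>s\<close> close to the stationary distribution.
\<close>


section \<open>Reversible random walks\<close>

text \<open>The gap is read off a sorted list of roots of a characteristic polynomial, whereas the
  path needs pointwise convergence of a row vector. The bridge does without an orthonormal
  eigenbasis: maximising a norm on the complement of the constants yields an extremal eigenvalue, so
  bounds on single eigenvalues suffice. Multiplicity matters for the second entry of the list, which
  must be shown to be positive. The number \<open>s\<close> of steps does not depend on
  \<open>t\<close>, and the transition matrix does not enlarge l1 errors, so \<open>s\<close> errors
  of order sqrt t still sum to order sqrt t; this is the loss in the exponent. A further sqrt t in
  the exponent pays for the union bound. The tolerance \<epsilon> is split in halves, one for mixing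
  and one for the sampling error. The argument bounds the failure probability without the factor
  \<open>s\<close>, which is enough once \<open>s\<close> is at least 1; this holds for \<epsilon>
  \<le> 1. For \<epsilon> > 1 the step count may be 0, so that the claim demands probability 1, but
  then every vertex is balanced.\<close>

locale reversible_walk =
  fixes k :: nat and p :: "nat \<Rightarrow> nat \<Rightarrow> real" and c :: "nat \<Rightarrow> real"
  assumes p_sym: "i < k \<Longrightarrow> j < k \<Longrightarrow> p i j = p j i"
    and c_eq: "i < k \<Longrightarrow> (\<Sum>j<k. p i j) = c i"
    and c_pos: "i < k \<Longrightarrow> 0 < c i"
begin

text \<open>The weight \<open>c\<close> is proportional to the stationary distribution and makes
  \<open>averaging\<close> self-adjoint. Being orthogonal to the constant 1 means having stationary
  mean 0.\<close>

definition ip :: "(nat \<Rightarrow> real) \<Rightarrow> (nat \<Rightarrow> real) \<Rightarrow> real" where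
  "ip x y = (\<Sum>i<k. c i * (x i * y i))"

text \<open>For \<open>p\<close> and \<open>c\<close> coming from \<open>P\<close>, \<open>averaging x\<close> is the column vector \<open>M x\<close> and \<open>push x\<close> the row
  vector \<open>x M\<close>.\<close>

definition averaging :: "(nat \<Rightarrow> real) \<Rightarrow> nat \<Rightarrow> real" where
  "averaging x i = (\<Sum>j<k. p i j * x j) / c i"

definition push :: "(nat \<Rightarrow> real) \<Rightarrow> nat \<Rightarrow> real" where
  "push x j = (\<Sum>i<k. x i * (p i j / c i))"

lemma ip_cong: "(\<And>i. i < k \<Longrightarrow> x i = x' i) \<Longrightarrow> (\<And>i. i < k \<Longrightarrow> y i = y' i) \<Longrightarrow> ip x y = ip x' y'"
  by (simp add: ip_def)

lemma averaging_cong: "(\<And>i. i < k \<Longrightarrow> x i = x' i) \<Longrightarrow> averaging x = averaging x'"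
  by (simp add: averaging_def fun_eq_iff)

lemma ip_commute: "ip x y = ip y x"
  by (simp add: ip_def mult.commute)

lemma ip_add: "ip (\<lambda>i. a * x i + b * y i) z = a * ip x z + b * ip y z"
  by (simp add: ip_def algebra_simps sum.distrib sum_distrib_left)

lemma ip_add_right: "ip z (\<lambda>i. a * x i + b * y i) = a * ip z x + b * ip z y"
  by (simp add: ip_commute[of z] ip_add)

lemma averaging_lincomb:
  "averaging (\<lambda>i. a * x i + b * y i) i = a * averaging x i + b * averaging y i"
  by (simp add: averaging_def algebra_simps sum.distrib sum_distrib_left add_divide_distrib)

lemma averaging_const: "i < k \<Longrightarrow> averaging (\<lambda>_. a) i = a"
  using c_pos[of i] by (simp add: averaging_def sum_distrib_right[symmetric] c_eq)

lemma ip_nonneg: "0 \<le> ip x x"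
  unfolding ip_def by (intro sum_nonneg) (auto simp: less_imp_le c_pos)

lemma ip_eq_0: "ip x x = 0 \<Longrightarrow> i < k \<Longrightarrow> x i = 0"
proof -
  assume *: "ip x x = 0" "i < k"
  have "\<forall>i\<in>{..<k}. c i * (x i * x i) = 0"
    using *(1) unfolding ip_def
    by (subst (asm) sum_nonneg_eq_0_iff) (auto simp: less_imp_le c_pos)
  with *(2) c_pos[OF *(2)] show ?thesis by force
qed

lemma averaging_eq_0: "ip x x = 0 \<Longrightarrow> averaging x = (\<lambda>_. 0)"
  by (rule ext) (simp add: averaging_def ip_eq_0)

text \<open>The weight \<open>c i\<close> cancels the division in \<open>averaging\<close>, and what
  remains is the bilinear form of the symmetric \<open>p\<close>.\<close>

lemma averaging_self_adjoint: "ip (averaging x) y = ip x (averaging y)"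
proof -
  have l: "ip (averaging x) y = (\<Sum>i<k. \<Sum>j<k. p i j * x j * y i)" for x y
    unfolding ip_def averaging_def
    by (intro sum.cong refl) (auto simp: sum_distrib_right dest: c_pos)
  have "ip x (averaging y) = (\<Sum>i<k. \<Sum>j<k. p i j * y j * x i)"
    by (subst ip_commute) (rule l)
  also have "\<dots> = (\<Sum>j<k. \<Sum>i<k. p i j * y j * x i)" by (rule sum.swap)
  also have "\<dots> = ip (averaging x) y"
    unfolding l by (intro sum.cong refl) (auto simp: p_sym)
  finally show ?thesis by simp
qed

text \<open>Constants are fixed by a self-adjoint operator, so their orthogonal complement is
  invariant.\<close>

lemma averaging_orth: "ip x (\<lambda>_. 1) = 0 \<Longrightarrow> ip (averaging x) (\<lambda>_. 1) = 0"
proof -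
  assume "ip x (\<lambda>_. 1) = 0"
  moreover have "ip x (averaging (\<lambda>_. 1)) = ip x (\<lambda>_. 1)"
    by (intro ip_cong) (auto simp: averaging_const)
  ultimately show ?thesis by (simp add: averaging_self_adjoint)
qed

section \<open>Contraction on the complement of the constants\<close>

lemma coordinate_le_ip: "i < k \<Longrightarrow> c i * (x i)\<^sup>2 \<le> ip x x"
  unfolding ip_def power2_eq_square
  by (rule member_le_sum[of i "{..<k}" "\<lambda>i. c i * (x i * x i)"]) (auto simp: less_imp_le c_pos)

text \<open>Vectors are functions on all of \<open>nat\<close>, so the coordinates from
  \<open>k\<close> on are pinned to 0. The others are bounded because \<open>c\<close> is positive,
  and the set is closed in a product of compact sets.\<close>

lemma compact_unit_sphere:
  "compact {x. (\<forall>i\<ge>k. x i = 0) \<and> ip x x = 1 \<and> ip x (\<lambda>_. 1) = 0}" (is "compact ?K")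
proof -
  define B where "B = (\<lambda>i. if i < k then {- sqrt (1 / c i)..sqrt (1 / c i)} else {0::real})"
  have "compactin (product_topology (\<lambda>i. euclidean) UNIV) (PiE UNIV B)"
    unfolding compactin_PiE by (auto simp: B_def)
  hence cB: "compact (PiE UNIV B)"
    by (simp add: euclidean_product_topology)
  have cl: "closed ?K"
    unfolding ip_def Collect_conj_eq Collect_all_eq
    by (intro closed_Int closed_INT ballI closed_Collect_imp closed_Collect_eq continuous_intros
         continuous_on_product_coordinates) auto
  have "?K \<subseteq> PiE UNIV B"
  proof
    fix x assume x: "x \<in> ?K"
    have "x i \<in> B i" for i
    proof (cases "i < k")
      case True
      have "c i * (x i)\<^sup>2 \<le> 1" using coordinate_le_ip[OF True, of x] x by simp
      hence "(x i)\<^sup>2 \<le> 1 / c i" using c_pos[OF True] by (simp add: field_simps)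
      hence "\<bar>x i\<bar> \<le> sqrt (1 / c i)" by (simp add: real_le_rsqrt)
      thus ?thesis using True by (auto simp: B_def abs_le_iff)
    next
      case False
      thus ?thesis using x by (auto simp: B_def)
    qed
    thus "x \<in> PiE UNIV B" by auto
  qed
  hence "?K = PiE UNIV B \<inter> ?K" by blast
  thus ?thesis using compact_Int_closed[OF cB cl] by simp
qed

text \<open>A maximiser \<open>x\<close> of \<open>\<parallel>averaging x\<parallel>\<close>, with maximum \<open>m\<close>, satisfies
  \<open>(averaging - m) (averaging + m) x = 0\<close>, so that \<open>m\<close> or \<open>-m\<close> is an eigenvalue.\<close>

lemma averaging_norm_le:
  assumes eig: "\<And>x \<mu>. (\<exists>i<k. x i \<noteq> 0) \<Longrightarrow> ip x (\<lambda>_. 1) = 0 \<Longrightarrow>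
      (\<And>i. i < k \<Longrightarrow> averaging x i = \<mu> * x i) \<Longrightarrow> \<bar>\<mu>\<bar> \<le> \<rho>"
    and y: "ip y (\<lambda>_. 1) = 0"
  shows "ip (averaging y) (averaging y) \<le> \<rho>\<^sup>2 * ip y y"
proof -
  let ?N = "\<lambda>x. ip (averaging x) (averaging x)"
  let ?K = "{x. (\<forall>i\<ge>k. x i = 0) \<and> ip x x = 1 \<and> ip x (\<lambda>_. 1) = 0}"
  define nrm where "nrm = (\<lambda>y i. if i < k then y i / sqrt (ip y y) else (0::real))"
  have nrm_avg: "?N (nrm y) * ip y y = ?N y" and nrm_K: "nrm y \<in> ?K"
    if "ip y y \<noteq> 0" "ip y (\<lambda>_. 1) = 0" for y
  proof -
    have pos: "ip y y > 0" using that(1) ip_nonneg[of y] by simp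
    define a where "a = 1 / sqrt (ip y y)"
    have a: "a * a * ip y y = 1" using pos by (simp add: a_def)
    have e: "averaging (nrm y) = (\<lambda>i. a * averaging y i + 0 * averaging y i)"
      by (rule ext, subst averaging_lincomb[symmetric], rule fun_cong[OF averaging_cong])
         (simp add: nrm_def a_def)
    have "?N (nrm y) = a * a * ?N y"
      unfolding e ip_add ip_add_right by simp
    with a show "?N (nrm y) * ip y y = ?N y" by (simp add: algebra_simps)
    have e: "ip (nrm y) z = a * ip y z" for z
    proof -
      have "ip (nrm y) z = ip (\<lambda>i. a * y i + 0 * y i) z"
        by (rule ip_cong) (auto simp: nrm_def a_def)
      thus ?thesis by (simp add: ip_add[of a y 0 y, simplified])
    qed
    have "ip (nrm y) (nrm y) = a * a * ip y y"
      by (subst e, subst ip_commute, subst e) simp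
    with a e that show "nrm y \<in> ?K" by (auto simp: nrm_def)
  qed
  show ?thesis
  proof (cases "ip y y = 0")
    case True
    thus ?thesis using averaging_eq_0[OF True] by (simp add: ip_def)
  next
    case False
    have ne: "?K \<noteq> {}" using nrm_K[OF False y] by blast
    have "continuous_on ?K ?N"
      unfolding ip_def averaging_def
      by (intro continuous_intros) (auto dest: c_pos intro: continuous_on_product_coordinates
         continuous_on_subset)
    from continuous_attains_sup[OF compact_unit_sphere ne this]
    obtain x where x: "x \<in> ?K" and max: "\<And>z. z \<in> ?K \<Longrightarrow> ?N z \<le> ?N x" by blast
    define m where "m = sqrt (?N x)"
    have m2: "m * m = ?N x" and m0: "m \<ge> 0" using ip_nonneg by (auto simp: m_def)
    have bound: "?N z \<le> m * m * ip z z" if "ip z (\<lambda>_. 1) = 0" for z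
    proof (cases "ip z z = 0")
      case True
      thus ?thesis using averaging_eq_0[OF True] by (simp add: ip_def)
    next
      case False
      have "?N (nrm z) * ip z z \<le> ?N x * ip z z"
        by (rule mult_right_mono[OF max[OF nrm_K[OF False that]] ip_nonneg])
      thus ?thesis using nrm_avg[OF False that] m2 by simp
    qed
    have xo: "ip x (\<lambda>_. 1) = 0" and x1: "ip x x = 1" using x by auto
    \<comment> \<open>The squared norm of \<open>z\<close> expands to at most
      \<open>m^4 - 2 m^4 + m^4 = 0\<close>: the maximality bound is applied to
      \<open>averaging x\<close>, and self-adjointness turns the mixed term into the maximum
      itself.\<close>
    define z where "z = (\<lambda>i. 1 * averaging (averaging x) i + (- m * m) * x i)"
    have zz: "ip z z = ?N (averaging x) - 2 * (m * m) * ip (averaging (averaging x)) x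
        + (m * m) * (m * m) * ip x x"
      unfolding z_def ip_add ip_add_right
      by (simp add: ip_commute[of x "averaging (averaging x)"] algebra_simps)
    have "ip (averaging (averaging x)) x = m * m"
      by (simp only: averaging_self_adjoint[of "averaging x"] m2)
    moreover have "?N (averaging x) \<le> m * m * (m * m)"
      using bound[OF averaging_orth[OF xo]] by (simp only: m2)
    ultimately have "ip z z \<le> 0" unfolding zz x1 by simp
    hence z0: "ip z z = 0" using ip_nonneg[of z] by simp
    have sq: "averaging (averaging x) i = m * m * x i" if "i < k" for i
      using ip_eq_0[OF z0 that] by (simp add: z_def)
    define w where "w = (\<lambda>i. 1 * averaging x i + m * x i)"
    have "\<bar>m\<bar> \<le> \<rho>"
    proof (cases "\<exists>i<k. w i \<noteq> 0")
      case True
      have "averaging w i = m * w i" if "i < k" for i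
        using that unfolding w_def averaging_lincomb by (simp add: sq algebra_simps)
      moreover have "ip w (\<lambda>_. 1) = 0"
        unfolding w_def ip_add using xo averaging_orth[OF xo] by simp
      ultimately show ?thesis using eig[of w m] True by blast
    next
      case False
      have "\<exists>i<k. x i \<noteq> 0"
      proof (rule ccontr)
        assume "\<not> (\<exists>i<k. x i \<noteq> 0)"
        hence "ip x x = 0" by (simp add: ip_def)
        with x1 show False by simp
      qed
      moreover have "averaging x i = - m * x i" if "i < k" for i
        using False that by (auto simp: w_def)
      ultimately have "\<bar>- m\<bar> \<le> \<rho>" using eig[of x "- m"] xo by blast
      thus ?thesis by simp
    qed
    hence "m * m \<le> \<rho>\<^sup>2" using m0 by (auto simp: power2_eq_square intro: mult_mono)
    with bound[OF y] show ?thesis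
      using mult_right_mono[OF _ ip_nonneg, of "m * m" "\<rho>\<^sup>2" y] by linarith
  qed
qed

text \<open>This is reversibility: pushing masses forward acts on their densities
  \<open>x i / c i\<close> as \<open>averaging\<close> does, which makes the contraction available
  for row vectors.\<close>

lemma push_eq_averaging: "j < k \<Longrightarrow> push x j = c j * averaging (\<lambda>i. x i / c i) j"
  using c_pos[of j] unfolding push_def averaging_def
  by (auto intro!: sum.cong simp: p_sym)

lemma push_iterate_eq_averaging:
  "j < k \<Longrightarrow> (push ^^ n) x j = c j * (averaging ^^ n) (\<lambda>i. x i / c i) j"
proof (induction n arbitrary: j)
  case 0
  thus ?case using c_pos[of j] by simp
next
  case (Suc n)
  have "averaging (\<lambda>i. (push ^^ n) x i / c i) = averaging ((averaging ^^ n) (\<lambda>i. x i / c i))"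
    by (rule averaging_cong) (auto simp: Suc.IH dest: c_pos)
  thus ?case using push_eq_averaging[OF Suc.prems] by simp
qed

text \<open>The density of \<open>x\<close> splits into its mean \<open>1 / V\<close> and a part
  \<open>z\<close> orthogonal to the constants, whose norm shrinks by \<open>\<rho>\<close> in each
  step. One factor \<open>1 / sqrt a\<close> comes from the initial norm of a probability vector,
  the other from reading a coordinate off the norm.\<close>

lemma push_iterate_ge:
  assumes norm_le: "\<And>y. ip y (\<lambda>_. 1) = 0 \<Longrightarrow> ip (averaging y) (averaging y) \<le> \<rho>\<^sup>2 * ip y y"
    and \<rho>: "0 \<le> \<rho>"
    and x: "\<And>i. i < k \<Longrightarrow> 0 \<le> x i" "(\<Sum>i<k. x i) = 1"
    and a: "0 < a" "\<And>i. i < k \<Longrightarrow> a \<le> c i"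
    and i: "i < k"
  shows "(push ^^ n) x i \<ge> c i / (\<Sum>j<k. c j) - c i * \<rho> ^ n / a"
proof -
  define V where "V = (\<Sum>j<k. c j)"
  have V: "V > 0" unfolding V_def using i c_pos by (intro sum_pos) auto
  define y where "y = (\<lambda>i. x i / c i)"
  define z where "z = (\<lambda>i. 1 * y i + (- 1 / V) * 1)"
  have y1: "ip y (\<lambda>_. 1) = 1"
  proof -
    have "ip y (\<lambda>_. 1) = (\<Sum>i<k. x i)"
      unfolding ip_def y_def by (intro sum.cong refl) (auto dest: c_pos)
    thus ?thesis using x(2) by simp
  qed
  have one: "ip (\<lambda>_. 1) (\<lambda>_. 1) = V" by (simp add: ip_def V_def)
  have zo: "ip z (\<lambda>_. 1) = 0" unfolding z_def ip_add using y1 one V by simp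
  have "ip z z = 1 * ip z y + (- 1 / V) * ip z (\<lambda>_. 1)"
    unfolding ip_add_right[symmetric] by (simp add: z_def)
  also have "\<dots> = ip z y" using zo by simp
  also have "\<dots> = ip y y - 1 / V"
    unfolding z_def ip_add using y1 by (simp add: ip_commute[of "\<lambda>_. 1" y])
  finally have "ip z z \<le> ip y y" using V by simp
  also have "ip y y = (\<Sum>i<k. x i * (x i / c i))"
    unfolding ip_def y_def by (intro sum.cong refl) (auto dest: c_pos)
  also have "\<dots> \<le> (\<Sum>i<k. x i * (1 / a))"
  proof (intro sum_mono mult_left_mono)
    fix j assume "j \<in> {..<k}"
    hence j: "j < k" by simp
    have "x j \<le> 1" using member_le_sum[of j "{..<k}" x] x j by auto
    thus "x j / c j \<le> 1 / a" using a(2)[OF j] a(1) x(1)[OF j] by (intro frac_le) auto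
    show "0 \<le> x j" using x j by simp
  qed
  also have "\<dots> = 1 / a" unfolding sum_distrib_right[symmetric] x(2) by simp
  finally have zz: "ip z z \<le> 1 / a" .
  have it: "ip ((averaging ^^ n) z) (\<lambda>_. 1) = 0 \<and>
      ip ((averaging ^^ n) z) ((averaging ^^ n) z) \<le> (\<rho>\<^sup>2) ^ n * ip z z" for n
  proof (induction n)
    case 0 thus ?case using zo by simp
  next
    case (Suc n)
    let ?u = "(averaging ^^ n) z"
    have "ip (averaging ?u) (averaging ?u) \<le> \<rho>\<^sup>2 * ip ?u ?u" using norm_le Suc by blast
    also have "\<dots> \<le> \<rho>\<^sup>2 * ((\<rho>\<^sup>2) ^ n * ip z z)" using Suc by (intro mult_left_mono) auto
    finally show ?case using averaging_orth Suc by (simp add: mult.assoc)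
  qed
  have dec: "i < k \<Longrightarrow> (averaging ^^ n) y i = 1 / V + (averaging ^^ n) z i" for n i
  proof (induction n arbitrary: i)
    case 0 thus ?case by (simp add: z_def)
  next
    case (Suc n)
    have "averaging ((averaging ^^ n) y) = averaging (\<lambda>i. (1 / V) * 1 + 1 * (averaging ^^ n) z i)"
      by (rule averaging_cong) (simp add: Suc.IH)
    hence "(averaging ^^ Suc n) y i = averaging (\<lambda>i. (1 / V) * 1 + 1 * (averaging ^^ n) z i) i"
      by simp
    also have "\<dots> = 1 / V + (averaging ^^ Suc n) z i"
      unfolding averaging_lincomb by (simp add: averaging_const[OF Suc.prems])
    finally show ?case .
  qed
  let ?b = "(averaging ^^ n) z i"
  have "a * ?b\<^sup>2 \<le> c i * ?b\<^sup>2" using a(2)[OF i] by (intro mult_right_mono) auto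
  also have "\<dots> \<le> ip ((averaging ^^ n) z) ((averaging ^^ n) z)" by (rule coordinate_le_ip[OF i])
  also have "\<dots> \<le> (\<rho>\<^sup>2) ^ n * ip z z" using it by blast
  also have "\<dots> \<le> (\<rho>\<^sup>2) ^ n * (1 / a)" using zz by (intro mult_left_mono) auto
  finally have "?b\<^sup>2 \<le> (\<rho>\<^sup>2) ^ n * (1 / a) / a"
    by (subst pos_le_divide_eq[OF a(1)]) (simp only: mult.commute)
  also have "\<dots> = (\<rho> ^ n / a)\<^sup>2"
    by (simp add: power_divide power2_eq_square power_mult_distrib)
  finally have "?b\<^sup>2 \<le> (\<rho> ^ n / a)\<^sup>2" .
  hence "\<bar>?b\<bar> \<le> \<bar>\<rho> ^ n / a\<bar>" by (simp only: abs_le_square_iff)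
  also have "\<dots> = \<rho> ^ n / a" using a(1) \<rho> by simp
  finally have "\<bar>?b\<bar> \<le> \<rho> ^ n / a" .
  hence "1 / V - \<rho> ^ n / a \<le> (averaging ^^ n) y i" using dec[OF i, of n] by linarith
  hence "c i * (1 / V - \<rho> ^ n / a) \<le> (push ^^ n) x i"
    unfolding push_iterate_eq_averaging[OF i] y_def
    using c_pos[OF i] by (intro mult_left_mono) auto
  thus ?thesis by (simp add: V_def right_diff_distrib)
qed

end

section \<open>Eigenvalues of real symmetric matrices\<close>

text \<open>The form \<open>Q\<close> of an eigenvector is its own conjugate by symmetry, and it
  equals \<open>z\<close> times the positive squared norm \<open>S\<close>.\<close>

lemma symmetric_real_mat_eigenvalue_real:
  fixes A :: "real mat"
  assumes A: "A \<in> carrier_mat n n" and sym: "transpose_mat A = A"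
    and ev: "eigenvalue (map_mat complex_of_real A) z"
  shows "z \<in> \<real>"
proof -
  let ?a = "\<lambda>i j. complex_of_real (A $$ (i, j))"
  have sym': "A $$ (i, j) = A $$ (j, i)" if "i < n" "j < n" for i j
    using arg_cong[OF sym, of "\<lambda>B. B $$ (i, j)"] A that by simp
  from ev obtain v where v: "v \<in> carrier_vec n" "v \<noteq> 0\<^sub>v n"
      and Av: "map_mat complex_of_real A *\<^sub>v v = z \<cdot>\<^sub>v v"
    using A unfolding eigenvalue_def eigenvector_def by auto
  have comp: "(\<Sum>j<n. ?a i j * vec_index v j) = z * vec_index v i" if "i < n" for i
    using arg_cong[OF Av, of "\<lambda>w. vec_index w i"] A v that
    by (simp add: scalar_prod_def row_def lessThan_atLeast0)
  define S where "S = (\<Sum>i<n. (cmod (vec_index v i))\<^sup>2)"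
  define Q where "Q = (\<Sum>i<n. \<Sum>j<n. cnj (vec_index v i) * (?a i j * vec_index v j))"
  have "Q = (\<Sum>i<n. cnj (vec_index v i) * (z * vec_index v i))"
    unfolding Q_def sum_distrib_left[symmetric] by (intro sum.cong refl) (simp add: comp)
  also have "\<dots> = z * of_real S"
    unfolding S_def of_real_sum sum_distrib_left
    by (intro sum.cong refl) (simp only: complex_norm_square, simp only: ac_simps)
  finally have QS: "Q = z * of_real S" .
  have "cnj Q = (\<Sum>i<n. \<Sum>j<n. vec_index v i * (?a i j * cnj (vec_index v j)))"
    by (simp add: Q_def)
  also have "\<dots> = (\<Sum>j<n. \<Sum>i<n. vec_index v i * (?a i j * cnj (vec_index v j)))" by (rule sum.swap)
  also have "\<dots> = Q" unfolding Q_def by (intro sum.cong refl) (simp add: sym')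
  finally have "Im Q = 0" by (metis complex_cnj_cancel_iff Im_complex_of_real Reals_cnj_iff complex_is_Real_iff)
  moreover have "S > 0"
  proof -
    obtain i where "i < n" "vec_index v i \<noteq> 0" using v by (metis eq_vecI carrier_vecD index_zero_vec)
    thus ?thesis unfolding S_def by (intro sum_pos2[of _ i]) auto
  qed
  ultimately show ?thesis using QS by (simp add: complex_is_Real_iff)
qed

text \<open>Over the reals \<open>proots\<close> may miss roots. Here each complex root is real and
  can be split off as a real linear factor, so induction on the degree recovers all of them.\<close>

lemma real_rooted_poly_factorization:
  fixes p :: "real poly"
  assumes "p \<noteq> 0" and "\<And>z. poly (map_poly complex_of_real p) z = 0 \<Longrightarrow> z \<in> \<real>"
  shows "size (proots p) = degree p \<and> p = Polynomial.smult (lead_coeff p) (\<Prod>x\<in>#proots p. [:- x, 1:])"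
  using assms
proof (induction "degree p" arbitrary: p)
  case 0
  then obtain a where a: "p = [:a:]" using degree_0_id by metis
  have "size (proots p) = 0" using size_proots_le[of p] 0 by simp
  thus ?case using a 0 by simp
next
  case (Suc n)
  interpret H: map_poly_comm_ring_hom complex_of_real ..
  have "degree (map_poly complex_of_real p) \<noteq> 0" using Suc.hyps by simp
  hence "\<not> constant (poly (map_poly complex_of_real p))" by (simp add: constant_degree)
  from fundamental_theorem_of_algebra[OF this] obtain z
    where z: "poly (map_poly complex_of_real p) z = 0" by blast
  obtain r where r: "z = of_real r" using Suc.prems(2)[OF z] by (auto elim: Reals_cases)
  have "poly p r = 0" using z unfolding r by (simp add: of_real_hom.poly_map_poly)
  then obtain q where q: "p = [:- r, 1:] * q" by (auto simp: poly_eq_0_iff_dvd elim: dvdE)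
  have q0: "q \<noteq> 0" using Suc.prems q by auto
  have dq: "n = degree q" using Suc.hyps q q0 by (simp add: degree_mult_eq del: mult_pCons_left)
  have "map_poly complex_of_real p = map_poly complex_of_real [:- r, 1:] * map_poly complex_of_real q"
    unfolding q by (rule H.hom_mult)
  hence "poly (map_poly complex_of_real q) z = 0 \<Longrightarrow> z \<in> \<real>" for z
    using Suc.prems(2)[of z] by simp
  from Suc.hyps(1)[OF dq q0 this]
  have IH: "size (proots q) = degree q" "q = Polynomial.smult (lead_coeff q) (\<Prod>x\<in>#proots q. [:- x, 1:])"
    by blast+
  have pr: "proots p = {#r#} + proots q"
    unfolding q by (subst proots_mult) (use q0 in auto)
  have lc: "lead_coeff p = lead_coeff q" unfolding q by (simp only: lead_coeff_mult) simp
  have "Polynomial.smult (lead_coeff p) (\<Prod>x\<in>#proots p. [:- x, 1:]) = [:- r, 1:] * Polynomial.smult (lead_coeff q) (\<Prod>x\<in>#proots q. [:- x, 1:])"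
    unfolding pr lc by simp
  also have "\<dots> = p" using IH(2) q by simp
  finally show ?case using pr IH dq Suc.hyps by simp
qed

text \<open>No root is lost when only real ones are collected, so the positions 1 and
  \<open>n - 1\<close> of the list have their intended meaning for \<open>n\<close> at least 2. The
  product form is the input that the Schur decomposition expects.\<close>

lemma symmetric_mat_sorted_eigenvalues:
  fixes A :: "real mat"
  assumes A: "A \<in> carrier_mat n n" and sym: "transpose_mat A = A"
  shows "length (sorted_eigenvalues A) = n"
    and "e \<in> set (sorted_eigenvalues A) \<longleftrightarrow> eigenvalue A e"
    and "char_poly A = (\<Prod>e\<leftarrow>sorted_eigenvalues A. [:- e, 1:])"
proof -
  let ?p = "char_poly A"
  note dm = degree_monic_char_poly[OF A]
  have p0: "?p \<noteq> 0" using dm by auto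
  have "poly (map_poly complex_of_real ?p) z = 0 \<Longrightarrow> z \<in> \<real>" for z
    unfolding of_real_hom.char_poly_hom[OF A, symmetric]
    by (rule symmetric_real_mat_eigenvalue_real[OF A sym])
       (subst eigenvalue_root_char_poly[of _ n], use A in auto)
  note fact = real_rooted_poly_factorization[OF p0 this]
  have ms: "mset (sorted_eigenvalues A) = proots ?p" by (simp add: sorted_eigenvalues_def)
  show "length (sorted_eigenvalues A) = n"
    using fact dm ms by (metis size_mset)
  show "e \<in> set (sorted_eigenvalues A) \<longleftrightarrow> eigenvalue A e"
    unfolding set_mset_mset[symmetric] ms eigenvalue_root_char_poly[OF A] using p0 by simp
  have "?p = (\<Prod>x\<in>#proots ?p. [:- x, 1:])" using fact dm by simp
  also have "\<dots> = (\<Prod>e\<leftarrow>sorted_eigenvalues A. [:- e, 1:])"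
    unfolding ms[symmetric] by (simp add: prod_mset_prod_list[symmetric])
  finally show "char_poly A = (\<Prod>e\<leftarrow>sorted_eigenvalues A. [:- e, 1:])" .
qed

text \<open>Algebraic multiplicity two forces geometric multiplicity two: the second column of a
  triangularising basis is annihilated by \<open>A\<^sup>2\<close>, hence by the symmetric matrix \<open>A\<close>.\<close>

lemma symmetric_mat_double_zero_eigenvalue:
  fixes A :: "real mat"
  assumes A: "A \<in> carrier_mat n n" and sym: "transpose_mat A = A" and n: "2 \<le> n"
    and z: "sorted_eigenvalues A ! 0 = 0" "sorted_eigenvalues A ! 1 = 0"
  obtains v w where "v \<in> carrier_vec n" "w \<in> carrier_vec n"
    "A *\<^sub>v v = 0\<^sub>v n" "A *\<^sub>v w = 0\<^sub>v n"
    "\<And>a b. a \<cdot>\<^sub>v v + b \<cdot>\<^sub>v w = 0\<^sub>v n \<Longrightarrow> a = 0 \<and> b = 0"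
proof -
  let ?es = "sorted_eigenvalues A"
  obtain B P Q where sd: "schur_decomposition A ?es = (B, P, Q)" by (metis prod_cases3)
  have "similar_mat_wit A B P Q \<and> upper_triangular B \<and> diag_mat B = ?es"
    by (rule schur_decomposition[OF A symmetric_mat_sorted_eigenvalues(3)[OF A sym] sd])
  hence sim: "similar_mat_wit A B P Q" and ut: "upper_triangular B" and dg: "diag_mat B = ?es"
    by auto
  note S = similar_mat_witD2[OF A sim]
  have B: "B \<in> carrier_mat n n" and P: "P \<in> carrier_mat n n" and Q: "Q \<in> carrier_mat n n"
    and PQ: "P * Q = 1\<^sub>m n" and QP: "Q * P = 1\<^sub>m n" and AB: "A = P * B * Q" using S by auto
  \<comment> \<open>The diagonal of \<open>B\<close> lists the eigenvalues in the given order, so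
    the leading 2 by 2 block of \<open>B\<close> is strictly upper triangular.\<close>
  have B00: "B $$ (0, 0) = 0" and B11: "B $$ (1, 1) = 0"
    using z n B unfolding dg[symmetric] diag_mat_def by auto
  have APu: "A *\<^sub>v (P *\<^sub>v u) = P *\<^sub>v (B *\<^sub>v u)" if u: "u \<in> carrier_vec n" for u
  proof -
    have "A * P = P * B" unfolding AB using P B Q QP
      by (metis assoc_mult_mat mult_carrier_mat right_mult_one_mat)
    thus ?thesis using A B P u by (metis assoc_mult_mat_vec)
  qed
  let ?u = "\<lambda>i. unit_vec n i :: real Matrix.vec"
  have B0: "B *\<^sub>v ?u 0 = 0\<^sub>v n"
  proof (rule eq_vecI)
    fix i assume "i < dim_vec (0\<^sub>v n :: real Matrix.vec)"
    hence i: "i < n" by simp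
    have "B $$ (i, 0) = 0"
      using B00 ut i B unfolding upper_triangular_def by (cases "i = 0") auto
    thus "vec_index (B *\<^sub>v ?u 0) i = vec_index (0\<^sub>v n) i" using i n B by simp
  qed (use B in auto)
  have B1: "B *\<^sub>v ?u 1 = (B $$ (0, 1)) \<cdot>\<^sub>v ?u 0"
  proof (rule eq_vecI)
    fix i assume "i < dim_vec ((B $$ (0, 1)) \<cdot>\<^sub>v ?u 0)"
    hence i: "i < n" by simp
    have "B $$ (i, 1) = (if i = 0 then B $$ (0, 1) else 0)"
      using B11 ut i B unfolding upper_triangular_def
      by (cases "i = 0"; cases "i = 1") auto
    thus "vec_index (B *\<^sub>v ?u 1) i = vec_index ((B $$ (0, 1)) \<cdot>\<^sub>v ?u 0) i" using i n B by simp
  qed (use B in auto)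
  define v w where "v = P *\<^sub>v ?u 0" and "w = P *\<^sub>v ?u 1"
  have v: "v \<in> carrier_vec n" and w: "w \<in> carrier_vec n" using P by (auto simp: v_def w_def)
  have P0: "P *\<^sub>v 0\<^sub>v n = 0\<^sub>v n" using P by (intro eq_vecI) auto
  have Av: "A *\<^sub>v v = 0\<^sub>v n" unfolding v_def by (simp add: APu B0 P0)
  have Aw: "A *\<^sub>v w = (B $$ (0, 1)) \<cdot>\<^sub>v v"
    unfolding w_def v_def using P by (simp only: APu B1[symmetric] unit_vec_carrier mult_mat_vec[OF P unit_vec_carrier, symmetric])
  have AAw: "A *\<^sub>v (A *\<^sub>v w) = 0\<^sub>v n"
    unfolding Aw using A v Av by (simp add: mult_mat_vec) (intro eq_vecI, auto)
  have "(A *\<^sub>v w) \<bullet> (A *\<^sub>v w) = w \<bullet> (A *\<^sub>v (A *\<^sub>v w))"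
    using transpose_vec_mult_scalar[OF A w, of "A *\<^sub>v w"] A w sym
    by (metis comm_scalar_prod mult_mat_vec_carrier)
  also have "\<dots> = 0" using AAw w by simp
  finally have Aw0: "A *\<^sub>v w = 0\<^sub>v n"
  proof -
    assume 0: "(A *\<^sub>v w) \<bullet> (A *\<^sub>v w) = 0"
    have "vec_index (A *\<^sub>v w) i = 0" if "i < n" for i
    proof -
      have "(\<Sum>i\<in>{0..<n}. vec_index (A *\<^sub>v w) i * vec_index (A *\<^sub>v w) i) = 0"
        using 0 A by (simp add: scalar_prod_def del: index_mult_mat_vec)
      hence "\<forall>i\<in>{0..<n}. vec_index (A *\<^sub>v w) i * vec_index (A *\<^sub>v w) i = 0"
        by (subst (asm) sum_nonneg_eq_0_iff) auto
      thus ?thesis using that by simp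
    qed
    thus ?thesis using A by (intro eq_vecI) auto
  qed
  have ind: "a = 0 \<and> b = 0" if ab: "a \<cdot>\<^sub>v v + b \<cdot>\<^sub>v w = 0\<^sub>v n" for a b
  proof -
    let ?x = "a \<cdot>\<^sub>v ?u 0 + b \<cdot>\<^sub>v ?u 1"
    have "P *\<^sub>v ?x = 0\<^sub>v n"
      using ab P unfolding v_def w_def by (simp add: mult_add_distrib_mat_vec[of P n n] mult_mat_vec)
    hence "Q *\<^sub>v (P *\<^sub>v ?x) = 0\<^sub>v n" using Q by (intro eq_vecI) auto
    moreover have "Q *\<^sub>v (P *\<^sub>v ?x) = ?x"
      using P Q QP by (subst assoc_mult_mat_vec[symmetric, of _ n n _ n]) auto
    ultimately have x0: "?x = 0\<^sub>v n" by simp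
    from arg_cong[OF x0, of "\<lambda>u. vec_index u 0"] arg_cong[OF x0, of "\<lambda>u. vec_index u 1"] n
    show ?thesis by simp
  qed
  show ?thesis using that[OF v w Av Aw0 ind] .
qed

section \<open>Vertices and edges of the Kronecker graph\<close>

lemma kron_verts_0: "kron_verts k 0 = {[]}"
  by (auto simp: kron_verts_def)

lemma kron_verts_Suc: "kron_verts k (Suc t) = (\<lambda>(a, w). a # w) ` ({..<k} \<times> kron_verts k t)"
  by (force simp: kron_verts_def length_Suc_conv image_iff)

lemma finite_kron_verts: "finite (kron_verts k t)"
  by (induction t) (auto simp: kron_verts_0 kron_verts_Suc)

lemma card_kron_verts: "card (kron_verts k t) = k ^ t"
proof (induction t)
  case (Suc t)
  have "inj_on (\<lambda>(a, w). a # w) ({..<k} \<times> kron_verts k t)" by (auto simp: inj_on_def)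
  thus ?case using Suc by (simp add: kron_verts_Suc card_image Groups_Big.card_cartesian_product)
qed (simp add: kron_verts_0)

lemma sum_kron_verts_Suc:
  "(\<Sum>w\<in>kron_verts k (Suc t). g w) = (\<Sum>a<k. \<Sum>w\<in>kron_verts k t. g (a # w))"
proof -
  have "inj_on (\<lambda>(a, w). a # w) ({..<k} \<times> kron_verts k t)" by (auto simp: inj_on_def)
  thus ?thesis
    by (simp add: kron_verts_Suc sum.reindex sum.cartesian_product case_prod_unfold)
qed

lemma kron_verts_nth: "v \<in> kron_verts k t \<Longrightarrow> i < t \<Longrightarrow> v ! i < k"
  unfolding kron_verts_def using nth_mem[of i v] by fastforce

section \<open>Letter counts of a random neighbour\<close>

lemma sum_nth_eq_sum_count_list:
  fixes g :: "nat \<Rightarrow> real"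
  assumes "set u \<subseteq> {0..<k}"
  shows "(\<Sum>i<length u. g (u ! i)) = (\<Sum>l<k. real (count_list u l) * g l)"
  using assms
proof (induction u)
  case (Cons b u)
  have "(\<Sum>l<k. real (count_list (b # u) l) * g l)
      = (\<Sum>l<k. (if l = b then g l else 0) + real (count_list u l) * g l)"
    by (intro sum.cong) (auto simp: algebra_simps)
  also have "\<dots> = g b + (\<Sum>l<k. real (count_list u l) * g l)"
    using Cons.prems by (simp add: sum.distrib)
  finally show ?case using Cons by (simp add: sum.lessThan_Suc_shift del: sum.lessThan_Suc)
qed simp

text \<open>\<open>q u\<close> is the law of a vertex obtained from \<open>u\<close> by one
  independent walk step in every coordinate, and \<open>d u\<close> is the centred number of letters
  \<open>j\<close>. Splitting off the first coordinate adds a centred variable of absolute value at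
  most 1; the cross term vanishes, so each coordinate contributes at most 1 to the variance.\<close>

lemma random_neighbour_moments:
  fixes M :: "nat \<Rightarrow> nat \<Rightarrow> real"
  assumes M0: "\<And>i j. i < k \<Longrightarrow> j < k \<Longrightarrow> 0 \<le> M i j"
    and M1: "\<And>i. i < k \<Longrightarrow> (\<Sum>j<k. M i j) = 1"
    and j: "j < k" and u: "u \<in> kron_verts k t"
  defines "q \<equiv> \<lambda>u w. \<Prod>i<length u. M (u ! i) (w ! i)"
    and "d \<equiv> \<lambda>u w. real (count_list w j) - (\<Sum>i<length u. M (u ! i) j)"
  shows "(\<Sum>w\<in>kron_verts k t. q u w) = 1 \<and> (\<Sum>w\<in>kron_verts k t. q u w * d u w) = 0 \<and>
    (\<Sum>w\<in>kron_verts k t. q u w * (d u w)\<^sup>2) \<le> real t"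
  using u
proof (induction t arbitrary: u)
  case 0
  thus ?case by (simp add: kron_verts_0 q_def d_def)
next
  case (Suc t)
  then obtain b v where u: "u = b # v" and b: "b < k" and v: "v \<in> kron_verts k t"
    by (auto simp: kron_verts_Suc)
  note IH = Suc.IH[OF v]
  let ?V = "kron_verts k t"
  define e where "e = (\<lambda>a. (if a = j then 1 else 0) - M b j)"
  have qC: "q u (a # w) = M b a * q v w" for a w
    unfolding u q_def by (simp add: prod.lessThan_Suc_shift del: prod.lessThan_Suc)
  have dC: "d u (a # w) = e a + d v w" for a w
    unfolding u d_def e_def by (simp add: sum.lessThan_Suc_shift del: sum.lessThan_Suc)
  have Me: "(\<Sum>a<k. M b a * e a) = 0"
  proof -
    have "(\<Sum>a<k. M b a * e a) = (\<Sum>a<k. (if a = j then M b a else 0) - M b a * M b j)"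
      unfolding e_def by (intro sum.cong) (auto simp: algebra_simps)
    also have "\<dots> = M b j - (\<Sum>a<k. M b a) * M b j"
      using j by (simp add: sum_subtractf sum_distrib_right)
    finally show ?thesis using M1[OF b] by simp
  qed
  have "M b j \<le> 1"
    using member_le_sum[of j "{..<k}" "M b"] M1[OF b] M0[OF b] j by auto
  hence e1: "(e a)\<^sup>2 \<le> 1" for a
    using M0[OF b j] by (auto simp: e_def abs_square_le_1)
  have Me2: "(\<Sum>a<k. M b a * (e a)\<^sup>2) \<le> 1"
  proof -
    have "(\<Sum>a<k. M b a * (e a)\<^sup>2) \<le> (\<Sum>a<k. M b a * 1)"
      using e1 M0[OF b] by (intro sum_mono mult_left_mono) auto
    thus ?thesis using M1[OF b] by simp
  qed
  have "(\<Sum>w\<in>kron_verts k (Suc t). q u w) = (\<Sum>a<k. M b a * (\<Sum>w\<in>?V. q v w))"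
    by (simp add: sum_kron_verts_Suc qC sum_distrib_left)
  hence 1: "(\<Sum>w\<in>kron_verts k (Suc t). q u w) = 1" using IH M1[OF b] by simp
  have "(\<Sum>w\<in>kron_verts k (Suc t). q u w * d u w)
      = (\<Sum>a<k. M b a * e a * (\<Sum>w\<in>?V. q v w) + M b a * (\<Sum>w\<in>?V. q v w * d v w))"
    unfolding sum_kron_verts_Suc qC dC sum_distrib_left sum.distrib[symmetric]
    by (intro sum.cong refl) (simp only: distrib_left mult_ac)
  hence 2: "(\<Sum>w\<in>kron_verts k (Suc t). q u w * d u w) = 0" using IH Me by simp
  have "(\<Sum>w\<in>kron_verts k (Suc t). q u w * (d u w)\<^sup>2)
      = (\<Sum>a<k. M b a * (e a)\<^sup>2 * (\<Sum>w\<in>?V. q v w) + 2 * M b a * e a * (\<Sum>w\<in>?V. q v w * d v w)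
          + M b a * (\<Sum>w\<in>?V. q v w * (d v w)\<^sup>2))"
    unfolding sum_kron_verts_Suc qC dC sum_distrib_left sum.distrib[symmetric]
    by (intro sum.cong refl) (simp add: power2_eq_square distrib_left distrib_right mult_ac)
  also have "\<dots> = (\<Sum>a<k. M b a * (e a)\<^sup>2) + (\<Sum>w\<in>?V. q v w * (d v w)\<^sup>2)"
    using IH by (simp add: sum.distrib sum_distrib_right[symmetric] M1[OF b])
  also have "\<dots> \<le> 1 + real t" using Me2 IH by linarith
  finally show ?case using 1 2 by simp
qed

text \<open>With variance at most \<open>t\<close>, the threshold \<open>2 * k * t\<close> for
  squared deviations gives each letter failure weight at most \<open>1 / (2 * k)\<close> by
  Chebyshev, hence at most \<open>1 / 2\<close> over the \<open>k\<close> letters.\<close>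

lemma typical_neighbours_weight:
  fixes M :: "nat \<Rightarrow> nat \<Rightarrow> real"
  assumes M0: "\<And>i j. i < k \<Longrightarrow> j < k \<Longrightarrow> 0 \<le> M i j"
    and M1: "\<And>i. i < k \<Longrightarrow> (\<Sum>j<k. M i j) = 1"
    and k: "0 < k" and t: "0 < t" and u: "u \<in> kron_verts k t"
  shows "(\<Sum>w\<in>{w \<in> kron_verts k t. \<forall>j<k.
      \<bar>real (count_list w j) - (\<Sum>i<t. M (u ! i) j)\<bar> \<le> sqrt (2 * real k * real t)}.
        \<Prod>i<t. M (u ! i) (w ! i)) \<ge> 1 / 2"
proof -
  define q where "q = (\<lambda>w. \<Prod>i<t. M (u ! i) (w ! i))"
  define d where "d = (\<lambda>j w. real (count_list w j) - (\<Sum>i<t. M (u ! i) j))"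
  define s where "s = 2 * real k * real t"
  let ?V = "kron_verts k t"
  let ?T = "{w \<in> ?V. \<forall>j<k. \<bar>d j w\<bar> \<le> sqrt s}"
  have s: "s > 0" using k t by (simp add: s_def)
  have len: "length u = t" using u by (simp add: kron_verts_def)
  have mom: "(\<Sum>w\<in>?V. q w) = 1 \<and> (\<Sum>w\<in>?V. q w * (d j w)\<^sup>2) \<le> real t" if "j < k" for j
    using random_neighbour_moments[where M = M and k = k, OF _ _ that u, unfolded len] M0 M1
    unfolding q_def d_def by blast
  have sq1: "(\<Sum>w\<in>?V. q w) = 1" using mom k by blast
  have q0: "q w \<ge> 0" if "w \<in> ?V" for w
    unfolding q_def using kron_verts_nth[OF u] kron_verts_nth[OF that]
    by (intro prod_nonneg) (auto intro: M0)
  have "(\<Sum>w\<in>?V - ?T. q w) \<le> (\<Sum>w\<in>?V - ?T. \<Sum>j<k. q w * (d j w)\<^sup>2 / s)"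
  proof (rule sum_mono)
    fix w assume w: "w \<in> ?V - ?T"
    then obtain j where j: "j < k" "\<bar>d j w\<bar> > sqrt s" by fastforce
    have "s \<le> (d j w)\<^sup>2" using j(2) s
      by (metis less_imp_le power2_abs real_sqrt_ge_0_iff real_sqrt_le_iff real_sqrt_abs)
    hence "q w * 1 \<le> q w * ((d j w)\<^sup>2 / s)"
      using w q0 s by (intro mult_left_mono) auto
    also have "\<dots> = q w * (d j w)\<^sup>2 / s" by simp
    also have "\<dots> \<le> (\<Sum>j<k. q w * (d j w)\<^sup>2 / s)"
      by (rule member_le_sum) (use j w q0 s in auto)
    finally show "q w \<le> (\<Sum>j<k. q w * (d j w)\<^sup>2 / s)" by simp
  qed
  also have "\<dots> \<le> (\<Sum>w\<in>?V. \<Sum>j<k. q w * (d j w)\<^sup>2 / s)"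
    by (rule sum_mono2) (use q0 s finite_kron_verts in \<open>auto intro!: sum_nonneg\<close>)
  also have "\<dots> = (\<Sum>j<k. (\<Sum>w\<in>?V. q w * (d j w)\<^sup>2) / s)"
    by (subst sum.swap) (simp add: sum_divide_distrib)
  also have "\<dots> \<le> (\<Sum>j<k. real t / s)"
    using mom s by (intro sum_mono divide_right_mono) auto
  also have "\<dots> = 1 / 2" using k t by (simp add: s_def)
  finally have "(\<Sum>w\<in>?V - ?T. q w) \<le> 1 / 2" .
  moreover have "(\<Sum>w\<in>?V. q w) = (\<Sum>w\<in>?V - ?T. q w) + (\<Sum>w\<in>?T. q w)"
    by (rule sum.subset_diff) (auto simp: finite_kron_verts)
  ultimately show ?thesis using sq1 unfolding q_def d_def s_def by linarith
qed

section \<open>Independent edges at a vertex\<close>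

lemma finite_kron_pairs: "finite (kron_pairs k t)"
proof (rule finite_subset)
  show "kron_pairs k t \<subseteq> Pow (kron_verts k t)" by (auto simp: kron_pairs_def)
qed (simp add: finite_kron_verts)

lemma symmetric_mat_index:
  "P \<in> carrier_mat k k \<Longrightarrow> transpose_mat P = P \<Longrightarrow> i < k \<Longrightarrow> j < k \<Longrightarrow> P $$ (i, j) = P $$ (j, i)"
  by (metis carrier_matD index_transpose_mat(1))

lemma pair_prob_eq:
  assumes P: "P \<in> carrier_mat k k" "transpose_mat P = P"
    and u: "u \<in> kron_verts k t" and v: "v \<in> kron_verts k t"
  shows "pair_prob P t {u, v} = (\<Prod>i<t. P $$ (u ! i, v ! i))"
  unfolding pair_prob_def
proof (rule the_equality)
  have *: "(\<Prod>i<t. P $$ (v ! i, u ! i)) = (\<Prod>i<t. P $$ (u ! i, v ! i))"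
    by (intro prod.cong refl symmetric_mat_index[OF P]) (use u v kron_verts_nth in auto)
  fix p assume "\<exists>u' v'. {u, v} = {u', v'} \<and> p = (\<Prod>i<t. P $$ (u' ! i, v' ! i))"
  thus "p = (\<Prod>i<t. P $$ (u ! i, v ! i))" using * by (auto simp: doubleton_eq_iff)
qed blast

lemma pair_prob_bounds:
  assumes P: "P \<in> carrier_mat k k" "transpose_mat P = P"
    and P01: "\<forall>i<k. \<forall>j<k. 0 \<le> P $$ (i, j) \<and> P $$ (i, j) \<le> 1"
    and u: "u \<in> kron_verts k t" and v: "v \<in> kron_verts k t"
  shows "0 \<le> pair_prob P t {u, v}" "pair_prob P t {u, v} \<le> 1"
  unfolding pair_prob_eq[OF P u v]
  using P01 kron_verts_nth[OF u] kron_verts_nth[OF v]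
  by (auto intro!: prod_nonneg prod_le_1)

text \<open>Distinct \<open>w\<close> give distinct and hence independent pairs, so the probability
  is a product of factors \<open>1 - p \<le> exp (- p)\<close>. \<open>T\<close> avoids
  \<open>u\<close> because a vertex forms no pair with itself.\<close>

lemma prob_no_neighbour_le:
  assumes P: "P \<in> carrier_mat k k" "transpose_mat P = P"
    and P01: "\<forall>i<k. \<forall>j<k. 0 \<le> P $$ (i, j) \<and> P $$ (i, j) \<le> 1"
    and u: "u \<in> kron_verts k t" and T: "T \<subseteq> kron_verts k t - {u}"
  shows "measure_pmf.prob (kronecker_graph P t) {G. \<forall>w\<in>T. (u, w) \<notin> parcs G}
      \<le> exp (- (\<Sum>w\<in>T. pair_prob P t {u, w}))"
proof -
  have dim: "dim_row P = k" using P by auto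
  let ?E = "kron_pairs k t" and ?pp = "pair_prob P t"
  let ?I = "(\<lambda>w. {u, w}) ` T"
  let ?B = "\<lambda>e. if e \<in> ?I then {False} else UNIV"
  have IE: "?I \<subseteq> ?E" using u T by (force simp: kron_pairs_def)
  have inj: "inj_on (\<lambda>w. {u, w}) T" by (auto simp: inj_on_def doubleton_eq_iff)
  have pp: "0 \<le> ?pp {u, w}" "?pp {u, w} \<le> 1" if "w \<in> T" for w
    using pair_prob_bounds[OF P P01 u] T that by auto
  have "measure_pmf.prob (kronecker_graph P t) {G. \<forall>w\<in>T. (u, w) \<notin> parcs G}
      = measure_pmf.prob (Pi_pmf ?E False (\<lambda>e. bernoulli_pmf (?pp e))) (Pi ?E ?B)"
    unfolding kronecker_graph_def dim
    using IE by (subst measure_map_pmf) (intro arg_cong2[where f = measure], auto simp: Pi_def)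
  also have "\<dots> = (\<Prod>e\<in>?E. measure_pmf.prob (bernoulli_pmf (?pp e)) (?B e))"
    by (rule measure_Pi_pmf_Pi[OF finite_kron_pairs])
  also have "\<dots> = (\<Prod>e\<in>?I. measure_pmf.prob (bernoulli_pmf (?pp e)) (?B e))"
    by (rule prod.mono_neutral_right[OF finite_kron_pairs IE]) auto
  also have "\<dots> = (\<Prod>w\<in>T. 1 - ?pp {u, w})"
    by (subst prod.reindex[OF inj])
       (auto intro!: prod.cong simp: measure_pmf_single pp)
  also have "\<dots> \<le> (\<Prod>w\<in>T. exp (- ?pp {u, w}))"
    by (intro prod_mono) (use pp exp_ge_add_one_self[of "- ?pp {u, _}"] in force)
  also have "\<dots> = exp (- (\<Sum>w\<in>T. ?pp {u, w}))"
    using finite_subset[OF T] by (simp add: exp_sum finite_kron_verts flip: sum_negf)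
  finally show ?thesis .
qed

section \<open>The spectral gap\<close>

lemma arcs_ends_weight_graph:
  "arcs_ends (with_proj (weight_graph P))
    = {(i, j). i < dim_row P \<and> j < dim_row P \<and> P $$ (i, j) > 0}"
  by (simp add: weight_graph_def arcs_ends_def arc_to_ends_def)

text \<open>The form in which connectedness is applied throughout. The path lives in the symmetric
  closure, so the value of \<open>f\<close> is carried along arcs in either direction.\<close>

lemma weight_graph_connected_const:
  assumes con: "Digraph_Component.connected (with_proj (weight_graph P))"
    and f: "\<And>i j. i < dim_row P \<Longrightarrow> j < dim_row P \<Longrightarrow> P $$ (i, j) > 0 \<Longrightarrow> f i = f j"
    and ij: "i < dim_row P" "j < dim_row P"
  shows "f i = f j"
proof -
  let ?S = "with_proj (mk_symmetric (with_proj (weight_graph P)))"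
  have "reachable ?S i j"
    using con ij unfolding Digraph_Component.connected_def strongly_connected_def
    by (simp add: weight_graph_def)
  hence "(i, j) \<in> (arcs_ends ?S)\<^sup>*" by (rule reachable_rtranclI)
  thus ?thesis
  proof (induction rule: rtrancl_induct)
    case (step y z)
    have "(y, z) \<in> parcs (mk_symmetric (with_proj (weight_graph P)))"
      using step.hyps(2) by (simp add: arcs_ends_def arc_to_ends_def)
    hence "f y = f z" unfolding parcs_mk_symmetric by (auto simp: weight_graph_def dest: f)
    thus ?case using step.IH by simp
  qed simp
qed

text \<open>The bound \<open>2 \<le> k\<close> sets apart the graphs with at most one vertex, for
  which the spectral gap is unspecified; these are treated directly.\<close>

locale kronecker_generator =
  fixes P :: "real mat" and k :: nat
  assumes P_carrier: "P \<in> carrier_mat k k"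
    and P01: "\<forall>i<k. \<forall>j<k. 0 \<le> P $$ (i, j) \<and> P $$ (i, j) \<le> 1"
    and P_sym: "transpose_mat P = P"
    and P_connected: "Digraph_Component.connected (with_proj (weight_graph P))"
    and P_nonbipartite: "\<not> bipartite (with_proj (weight_graph P))"
    and k2: "2 \<le> k"
begin

lemma dim_P [simp]: "dim_row P = k" "dim_col P = k"
  using P_carrier by auto

lemma P_nonneg: "i < k \<Longrightarrow> j < k \<Longrightarrow> 0 \<le> P $$ (i, j)"
  using P01 by blast

lemma P_swap: "i < k \<Longrightarrow> j < k \<Longrightarrow> P $$ (i, j) = P $$ (j, i)"
  by (rule symmetric_mat_index[OF P_carrier P_sym])

text \<open>A vertex with column sum 0 is isolated, so its indicator does not change along any edge,
  yet it takes another value at a second vertex.\<close>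

lemma col_sum_pos: assumes i: "i < k" shows "0 < col_sum P i"
proof (rule ccontr)
  assume "\<not> 0 < col_sum P i"
  moreover have "0 \<le> col_sum P i" unfolding col_sum_def using P_nonneg i by (auto intro!: sum_nonneg)
  ultimately have "(\<Sum>l<k. P $$ (l, i)) = 0" by (simp add: col_sum_def)
  hence "\<forall>l\<in>{..<k}. P $$ (l, i) = 0"
    by (subst (asm) sum_nonneg_eq_0_iff) (use P_nonneg i in auto)
  hence z: "P $$ (l, i) = 0" "P $$ (i, l) = 0" if "l < k" for l
    using that P_swap[OF i that] by auto
  define j :: nat where "j = (if i = 0 then 1 else 0)"
  have j: "j < k" "j \<noteq> i" using k2 by (auto simp: j_def)
  have "(i = i) = (j = i)"
    by (rule weight_graph_connected_const[OF P_connected, of "\<lambda>l. l = i"]) (use z i j in auto)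
  with j show False by simp
qed

sublocale reversible_walk k "\<lambda>i j. P $$ (i, j)" "col_sum P"
proof unfold_locales
  show "(\<Sum>j<k. P $$ (i, j)) = col_sum P i" if "i < k" for i
    unfolding col_sum_def using that by (auto intro!: sum.cong P_swap)
qed (auto intro: P_swap col_sum_pos)

lemma vol_pos: "0 < vol P"
  unfolding vol_def using k2 col_sum_pos by (intro sum_pos) (auto simp: lessThan_empty_iff)

text \<open>For \<open>s = 1\<close> the left side is the Dirichlet form, for \<open>s = - 1\<close>
  its signless analogue. Keeping \<open>s\<close> as a parameter serves both ends of the
  spectrum.\<close>

lemma dirichlet_form:
  assumes x: "\<And>i. i < k \<Longrightarrow> averaging x i = \<mu> * x i" and s: "s * s = 1"
  shows "(\<Sum>i<k. \<Sum>j<k. P $$ (i, j) * (x i - s * x j)\<^sup>2) = 2 * (1 - s * \<mu>) * ip x x"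
proof -
  have Px: "(\<Sum>j<k. P $$ (i, j) * x j) = \<mu> * (col_sum P i * x i)" if "i < k" for i
    using x[OF that] col_sum_pos[OF that] by (simp add: averaging_def field_simps)
  have "(\<Sum>i<k. \<Sum>j<k. P $$ (i, j) * (x i - s * x j)\<^sup>2)
     = (\<Sum>i<k. \<Sum>j<k. P $$ (i, j) * (x i * x i)) + (\<Sum>i<k. \<Sum>j<k. P $$ (i, j) * (x j * x j))
       - (\<Sum>i<k. \<Sum>j<k. 2 * s * x i * (P $$ (i, j) * x j))"
  proof -
    have "P $$ (i, j) * (x i - s * x j)\<^sup>2 = P $$ (i, j) * (x i * x i) + P $$ (i, j) * (x j * x j)
       - 2 * s * x i * (P $$ (i, j) * x j)" for i j
    proof -
      have "(x i - s * x j)\<^sup>2 = x i * x i + (s * s) * (x j * x j) - 2 * s * x i * x j"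
        by (simp add: power2_eq_square algebra_simps)
      hence e: "(x i - s * x j)\<^sup>2 = x i * x i + x j * x j - 2 * s * x i * x j" unfolding s by simp
      show ?thesis unfolding e by (simp add: algebra_simps)
    qed
    thus ?thesis by (simp add: sum.distrib sum_subtractf)
  qed
  also have "(\<Sum>i<k. \<Sum>j<k. P $$ (i, j) * (x i * x i)) = ip x x"
    unfolding ip_def by (intro sum.cong refl) (auto simp: sum_distrib_right[symmetric] c_eq)
  also have "(\<Sum>i<k. \<Sum>j<k. P $$ (i, j) * (x j * x j)) = (\<Sum>j<k. \<Sum>i<k. P $$ (i, j) * (x j * x j))"
    by (rule sum.swap)
  also have "\<dots> = ip x x"
    unfolding ip_def col_sum_def by (auto simp: sum_distrib_right intro!: sum.cong)
  also have "(\<Sum>i<k. \<Sum>j<k. 2 * s * x i * (P $$ (i, j) * x j)) = 2 * s * \<mu> * ip x x"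
    unfolding ip_def sum_distrib_left[symmetric]
    by (auto simp: Px sum_distrib_left intro!: sum.cong)
  finally show ?thesis by (simp add: algebra_simps)
qed

text \<open>The Dirichlet sum is nonnegative, which bounds the eigenvalue; in the extreme case the
  sum is 0, so each of its terms vanishes.\<close>

lemma averaging_eigenvalue_sign:
  assumes x: "\<And>i. i < k \<Longrightarrow> averaging x i = \<mu> * x i" and nz: "\<exists>i<k. x i \<noteq> 0" and s: "s * s = 1"
  shows "s * \<mu> \<le> 1"
    and "s * \<mu> = 1 \<Longrightarrow> i < k \<Longrightarrow> j < k \<Longrightarrow> P $$ (i, j) > 0 \<Longrightarrow> x i = s * x j"
proof -
  have pos: "ip x x > 0" using ip_eq_0[of x] ip_nonneg[of x] nz by fastforce
  note D = dirichlet_form[of x \<mu> s, OF x s]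
  have nn: "0 \<le> P $$ (i, j) * (x i - s * x j)\<^sup>2" if "i < k" "j < k" for i j
    using P_nonneg that by simp
  have "0 \<le> (\<Sum>i<k. \<Sum>j<k. P $$ (i, j) * (x i - s * x j)\<^sup>2)"
    using nn by (auto intro!: sum_nonneg)
  hence "0 \<le> 2 * (1 - s * \<mu>) * ip x x" using D by linarith
  thus "s * \<mu> \<le> 1" using pos by (simp add: zero_le_mult_iff)
  assume "s * \<mu> = 1" and i: "i < k" and j: "j < k" and Pij: "P $$ (i, j) > 0"
  hence "(\<Sum>i<k. \<Sum>j<k. P $$ (i, j) * (x i - s * x j)\<^sup>2) = 0" using D by simp
  hence "\<forall>i\<in>{..<k}. (\<Sum>j<k. P $$ (i, j) * (x i - s * x j)\<^sup>2) = 0"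
    by (subst (asm) sum_nonneg_eq_0_iff) (use nn in \<open>auto intro!: sum_nonneg\<close>)
  hence "(\<Sum>j<k. P $$ (i, j) * (x i - s * x j)\<^sup>2) = 0" using i by auto
  hence "\<forall>j\<in>{..<k}. P $$ (i, j) * (x i - s * x j)\<^sup>2 = 0"
    by (subst (asm) sum_nonneg_eq_0_iff) (use nn i in auto)
  thus "x i = s * x j" using j Pij by force
qed

lemma averaging_fixpoint_const:
  assumes x: "\<And>i. i < k \<Longrightarrow> averaging x i = x i" and ij: "i < k" "j < k"
  shows "x i = x j"
proof (cases "\<exists>i<k. x i \<noteq> 0")
  case True
  have "x i = x j" if "i < k" "j < k" "P $$ (i, j) > 0" for i j
    using averaging_eigenvalue_sign(2)[of x 1 1 i j] x True that by simp
  from weight_graph_connected_const[OF P_connected this] ij show ?thesis by simp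
qed (use ij in auto)

text \<open>An eigenvector for \<open>- 1\<close> changes sign along every edge. Its absolute value
  is then a nonzero constant by connectedness, and the two sign classes form a bipartition.\<close>

lemma averaging_eigenvalue_gt_minus_1:
  assumes x: "\<And>i. i < k \<Longrightarrow> averaging x i = \<mu> * x i" and nz: "\<exists>i<k. x i \<noteq> 0"
  shows "- 1 < \<mu>"
proof (rule ccontr)
  assume "\<not> - 1 < \<mu>"
  have m: "- 1 * - 1 = (1 :: real)" by simp
  have "- 1 * \<mu> \<le> 1" by (rule averaging_eigenvalue_sign(1)[of x \<mu>, OF x nz m])
  with \<open>\<not> - 1 < \<mu>\<close> have "- 1 * \<mu> = 1" by linarith
  from averaging_eigenvalue_sign(2)[of x \<mu>, OF x nz m this]
  have flip: "x i = - x j" if "i < k" "j < k" "P $$ (i, j) > 0" for i j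
    using that by force
  have "\<bar>x i\<bar> = \<bar>x j\<bar>" if "i < k" "j < k" for i j
    by (rule weight_graph_connected_const[OF P_connected, of "\<lambda>i. \<bar>x i\<bar>"])
       (use flip that in auto)
  hence x0: "x i \<noteq> 0" if "i < k" for i using nz that by (metis abs_eq_0)
  let ?A = "{i. i < k \<and> x i > 0}" and ?B = "{i. i < k \<and> x i < 0}"
  have "verts (with_proj (weight_graph P)) = ?A \<union> ?B"
    using x0 by (auto simp: weight_graph_def) (meson linorder_neqE_linordered_idom)
  moreover have "arcs_ends (with_proj (weight_graph P)) \<subseteq> ?A \<times> ?B \<union> ?B \<times> ?A"
    unfolding arcs_ends_weight_graph using flip x0
    by auto (metis linorder_neqE_linordered_idom neg_0_less_iff_less neg_less_0_iff_less)+
  ultimately have "bipartite (with_proj (weight_graph P))"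
    unfolding bipartite_def by (intro exI[of _ ?A] exI[of _ ?B]) auto
  with P_nonbipartite show False by simp
qed

section \<open>Spectrum of the normalized Laplacian\<close>

abbreviation lap :: "real mat" where "lap \<equiv> normalized_laplacian P"

lemma lap_carrier: "lap \<in> carrier_mat k k"
  using P_carrier by (auto simp: normalized_laplacian_def Let_def mat_diag_def)

lemma lap_index: "i < k \<Longrightarrow> j < k \<Longrightarrow>
   lap $$ (i, j) = (if i = j then 1 else 0) - P $$ (i, j) / (sqrt (col_sum P i) * sqrt (col_sum P j))"
  using P_carrier
  by (simp add: normalized_laplacian_def Let_def mat_diag_mult_left[of _ k k]
      mat_diag_mult_right[of _ k k])

lemma lap_sym: "transpose_mat lap = lap"
  using lap_carrier by (intro eq_matI) (auto simp: lap_index P_swap)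

text \<open>Conjugation by the square roots of the column sums turns the Laplacian into identity
  minus \<open>averaging\<close>; eigenvalues \<open>e\<close> and \<open>1 - e\<close>
  correspond.\<close>

lemma lap_mult_vec:
  assumes y: "y \<in> carrier_vec k" and i: "i < k"
  defines "x \<equiv> \<lambda>i. vec_index y i / sqrt (col_sum P i)"
  shows "vec_index (lap *\<^sub>v y) i = sqrt (col_sum P i) * (x i - averaging x i)"
proof -
  have yx: "vec_index y j = sqrt (col_sum P j) * x j" if "j < k" for j
    using col_sum_pos[OF that] by (simp add: x_def)
  have "vec_index (lap *\<^sub>v y) i = (\<Sum>j<k. lap $$ (i, j) * vec_index y j)"
    using lap_carrier y i by (simp add: scalar_prod_def lessThan_atLeast0)
  also have "\<dots> = (\<Sum>j<k. (if i = j then vec_index y j else 0) - P $$ (i, j) * x j / sqrt (col_sum P i))"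
    using i by (intro sum.cong refl) (auto simp: lap_index x_def algebra_simps)
  also have "\<dots> = vec_index y i - (\<Sum>j<k. P $$ (i, j) * x j) / sqrt (col_sum P i)"
    using i by (simp add: sum_subtractf sum_divide_distrib)
  also have "(\<Sum>j<k. P $$ (i, j) * x j) = sqrt (col_sum P i) * (sqrt (col_sum P i) * averaging x i)"
    using col_sum_pos[OF i] by (simp add: averaging_def flip: mult.assoc)
  finally show ?thesis using col_sum_pos[OF i] by (simp add: yx[OF i] right_diff_distrib)
qed

lemma lap_eigenvalueI:
  assumes nz: "\<exists>i<k. x i \<noteq> 0" and x: "\<And>i. i < k \<Longrightarrow> averaging x i = (1 - e) * x i"
  shows "eigenvalue lap e"
proof -
  define y where "y = Matrix.vec k (\<lambda>i. sqrt (col_sum P i) * x i)"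
  have y: "y \<in> carrier_vec k" by (simp add: y_def)
  have yx: "vec_index y i / sqrt (col_sum P i) = x i" if "i < k" for i
    using col_sum_pos[OF that] that by (simp add: y_def)
  have "lap *\<^sub>v y = e \<cdot>\<^sub>v y"
  proof (rule eq_vecI)
    fix i assume "i < dim_vec (e \<cdot>\<^sub>v y)"
    hence i: "i < k" using y by simp
    have "averaging (\<lambda>i. vec_index y i / sqrt (col_sum P i)) = averaging x"
      by (rule averaging_cong) (rule yx)
    hence "vec_index (lap *\<^sub>v y) i = sqrt (col_sum P i) * (x i - averaging x i)"
      using lap_mult_vec[OF y i] yx[OF i] by simp
    thus "vec_index (lap *\<^sub>v y) i = vec_index (e \<cdot>\<^sub>v y) i"
      using i x[OF i] by (simp add: y_def algebra_simps)
  qed (use lap_carrier y in auto)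
  moreover have "y \<noteq> 0\<^sub>v k"
  proof
    assume "y = 0\<^sub>v k"
    hence "vec_index y i = 0" if "i < k" for i using that by simp
    with nz show False using col_sum_pos by (force simp: y_def)
  qed
  ultimately show ?thesis
    using y lap_carrier unfolding eigenvalue_def eigenvector_def by auto
qed

lemma lap_eigenvalueD:
  assumes "eigenvalue lap e"
  shows "\<exists>x. (\<exists>i<k. x i \<noteq> 0) \<and> (\<forall>i<k. averaging x i = (1 - e) * x i)"
proof -
  from assms obtain y where y: "y \<in> carrier_vec k" "y \<noteq> 0\<^sub>v k" and ey: "lap *\<^sub>v y = e \<cdot>\<^sub>v y"
    using lap_carrier unfolding eigenvalue_def eigenvector_def by auto
  define x where "x = (\<lambda>i. vec_index y i / sqrt (col_sum P i))"
  have "averaging x i = (1 - e) * x i" if i: "i < k" for i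
  proof -
    have "sqrt (col_sum P i) * (x i - averaging x i) = e * vec_index y i"
      using lap_mult_vec[OF y(1) i] ey y i unfolding x_def by simp
    also have "vec_index y i = sqrt (col_sum P i) * x i" using col_sum_pos[OF i] by (simp add: x_def)
    finally have "sqrt (col_sum P i) * (x i - averaging x i) = sqrt (col_sum P i) * (e * x i)" by simp
    hence "x i - averaging x i = e * x i" using col_sum_pos[OF i] by simp
    thus ?thesis by (simp add: algebra_simps)
  qed
  moreover have "\<exists>i<k. x i \<noteq> 0"
  proof -
    obtain i where "i < k" "vec_index y i \<noteq> 0" using y by (metis eq_vecI carrier_vecD index_zero_vec)
    thus ?thesis using col_sum_pos by (force simp: x_def)
  qed
  ultimately show ?thesis by blast
qed

abbreviation evs :: "real list" where "evs \<equiv> sorted_eigenvalues lap"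

lemma evs_sorted: "sorted evs"
  by (simp add: sorted_eigenvalues_def)

lemma length_evs: "length evs = k"
  by (rule symmetric_mat_sorted_eigenvalues(1)[OF lap_carrier lap_sym])

lemma set_evs: "e \<in> set evs \<longleftrightarrow> eigenvalue lap e"
  by (rule symmetric_mat_sorted_eigenvalues(2)[OF lap_carrier lap_sym])

lemma evs_range: assumes "e \<in> set evs" shows "0 \<le> e" "e < 2"
proof -
  obtain x where nz: "\<exists>i<k. x i \<noteq> 0"
    and x: "\<And>i. i < k \<Longrightarrow> averaging x i = (1 - e) * x i"
    using lap_eigenvalueD[OF assms[unfolded set_evs]] by blast
  show "0 \<le> e" using averaging_eigenvalue_sign(1)[of x "1 - e" 1, OF x nz] by simp
  show "e < 2" using averaging_eigenvalue_gt_minus_1[of x "1 - e", OF x nz] by simp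
qed

lemma zero_in_evs: "0 \<in> set evs"
  unfolding set_evs by (rule lap_eigenvalueI[of "\<lambda>_. 1"]) (use k2 averaging_const in \<open>auto intro!: exI[of _ 0]\<close>)

lemma evs_0: "evs ! 0 = 0"
proof -
  obtain n where "n < k" "evs ! n = 0" using zero_in_evs length_evs by (metis in_set_conv_nth)
  hence "evs ! 0 \<le> 0" using sorted_nth_mono[OF evs_sorted, of 0 n] length_evs by simp
  moreover have "evs ! 0 \<in> set evs" using length_evs k2 by (intro nth_mem) simp
  ultimately show ?thesis using evs_range(1) by force
qed

text \<open>A second zero in the list would provide two independent kernel vectors, but on a
  connected graph each kernel vector is a multiple of the vector of square roots of column
  sums.\<close>

lemma evs_1: "evs ! 1 > 0"
proof (rule ccontr)
  assume "\<not> evs ! 1 > 0"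
  moreover have "evs ! 1 \<in> set evs" using length_evs k2 by (intro nth_mem) simp
  ultimately have "evs ! 1 = 0" using evs_range(1) by force
  from symmetric_mat_double_zero_eigenvalue[OF lap_carrier lap_sym k2 evs_0 this]
  obtain v w where v: "v \<in> carrier_vec k" "lap *\<^sub>v v = 0\<^sub>v k"
    and w: "w \<in> carrier_vec k" "lap *\<^sub>v w = 0\<^sub>v k"
    and ind: "\<And>a b. a \<cdot>\<^sub>v v + b \<cdot>\<^sub>v w = 0\<^sub>v k \<Longrightarrow> a = 0 \<and> b = 0" by metis
  have ker: "vec_index y i = (vec_index y 0 / sqrt (col_sum P 0)) * sqrt (col_sum P i)"
    if y: "y \<in> carrier_vec k" "lap *\<^sub>v y = 0\<^sub>v k" and i: "i < k" for y i
  proof -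
    define x where "x = (\<lambda>i. vec_index y i / sqrt (col_sum P i))"
    have "averaging x i = x i" if "i < k" for i
      using lap_mult_vec[OF y(1) that] y(2) col_sum_pos[OF that] that unfolding x_def by simp
    hence "x i = x 0" using averaging_fixpoint_const[of x i 0] i by simp
    thus ?thesis using col_sum_pos[OF i] by (simp add: x_def field_simps)
  qed
  have "(vec_index w 0) \<cdot>\<^sub>v v + (- vec_index v 0) \<cdot>\<^sub>v w = 0\<^sub>v k"
  proof (rule eq_vecI)
    fix i assume "i < dim_vec (0\<^sub>v k :: real Matrix.vec)"
    hence i: "i < k" by simp
    show "vec_index ((vec_index w 0) \<cdot>\<^sub>v v + (- vec_index v 0) \<cdot>\<^sub>v w) i = vec_index (0\<^sub>v k) i"
      using i v w ker[OF v i] ker[OF w i] by simp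
  qed (use v w in auto)
  from ind[OF this] have v0: "vec_index v 0 = 0" by simp
  have "1 \<cdot>\<^sub>v v + 0 \<cdot>\<^sub>v w = 0\<^sub>v k"
    by (rule eq_vecI) (use v w ker[OF v] v0 in auto)
  from ind[OF this] show False by simp
qed

lemma spectral_gap_eq: "spectral_gap P = min (evs ! 1) (2 - evs ! (k - 1))"
  by (simp add: spectral_gap_def Let_def)

lemma spectral_gap_pos: "0 < spectral_gap P"
proof -
  have "evs ! (k - 1) \<in> set evs" using length_evs k2 by (intro nth_mem) simp
  thus ?thesis using evs_1 evs_range(2) by (simp add: spectral_gap_eq)
qed

text \<open>Since the second eigenvalue is at most the last, one of the two terms of the minimum is
  at most 1. This makes \<open>1 - spectral_gap P\<close> a nonnegative contraction factor.\<close>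

lemma spectral_gap_le_1: "spectral_gap P \<le> 1"
proof -
  have "evs ! 1 \<le> evs ! (k - 1)" using sorted_nth_mono[OF evs_sorted, of 1 "k - 1"] length_evs k2 by simp
  thus ?thesis by (simp add: spectral_gap_eq min_def)
qed

text \<open>Orthogonality to the constants excludes \<open>\<mu> = 1\<close>, since fixed points are
  constant. So \<open>1 - \<mu>\<close> sits at a nonzero position of the list, between the two
  entries that define the gap.\<close>

lemma averaging_eigenvalue_le:
  assumes nz: "\<exists>i<k. x i \<noteq> 0" and orth: "ip x (\<lambda>_. 1) = 0"
    and x: "\<And>i. i < k \<Longrightarrow> averaging x i = \<mu> * x i"
  shows "\<bar>\<mu>\<bar> \<le> 1 - spectral_gap P"
proof -
  have "eigenvalue lap (1 - \<mu>)" by (rule lap_eigenvalueI[OF nz]) (simp add: x)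
  then obtain n where n: "n < k" "evs ! n = 1 - \<mu>"
    unfolding set_evs[symmetric] by (metis in_set_conv_nth length_evs)
  have "\<mu> \<noteq> 1"
  proof
    assume "\<mu> = 1"
    hence c: "x i = x 0" if "i < k" for i
      using averaging_fixpoint_const[of x i 0] x that by simp
    have "ip x (\<lambda>_. 1) = (\<Sum>i<k. col_sum P i) * x 0"
      unfolding ip_def sum_distrib_right
    proof (intro sum.cong refl)
      show "col_sum P i * (x i * 1) = col_sum P i * x 0" if "i \<in> {..<k}" for i
        using c[of i] that by simp
    qed
    hence "x 0 = 0" using orth vol_pos by (simp add: vol_def)
    moreover obtain i where "i < k" "x i \<noteq> 0" using nz by blast
    ultimately show False using c[of i] by simp
  qed
  hence "n \<noteq> 0" using n evs_0 by (metis eq_iff_diff_eq_0)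
  hence "evs ! 1 \<le> 1 - \<mu>" using sorted_nth_mono[OF evs_sorted, of 1 n] n length_evs by simp
  moreover have "1 - \<mu> \<le> evs ! (k - 1)"
    using sorted_nth_mono[OF evs_sorted, of n "k - 1"] n length_evs by simp
  ultimately show ?thesis unfolding spectral_gap_eq by linarith
qed

text \<open>The origin of the step count: \<open>(1 - gap) ^ s \<le> exp (- gap * s)\<close>, and
  \<open>s\<close> makes this at most \<open>c * \<epsilon> / (2 * vol P)\<close> for the smallest
  column sum \<open>c\<close>. Only half of \<epsilon> is spent here.\<close>

lemma push_iterate_mixing:
  assumes x: "\<And>i. i < k \<Longrightarrow> 0 \<le> x i" "(\<Sum>i<k. x i) = 1"
    and mono: "\<forall>i j. i \<le> j \<longrightarrow> j < k \<longrightarrow> col_sum P i \<le> col_sum P j"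
    and e: "0 < \<epsilon>" and s: "s \<ge> 1 / spectral_gap P * ln (2 * vol P / (col_sum P 0 * \<epsilon>))"
    and i: "i < k"
  shows "(push ^^ s) x i \<ge> (1 - \<epsilon> / 2) * stationary P i"
proof -
  let ?g = "spectral_gap P" and ?c = "col_sum P 0"
  have c0: "0 < ?c" using col_sum_pos i by simp
  have "ln (2 * vol P / (?c * \<epsilon>)) \<le> ?g * s"
    using s spectral_gap_pos by (simp add: field_simps)
  hence "2 * vol P / (?c * \<epsilon>) \<le> exp (?g * s)"
    using vol_pos c0 e by (metis divide_pos_pos exp_le_cancel_iff exp_ln mult_pos_pos zero_less_numeral)
  hence "exp (- (?g * s)) \<le> ?c * \<epsilon> / (2 * vol P)"
    using vol_pos c0 e by (simp add: exp_minus field_simps)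
  moreover have "(1 - ?g) ^ s \<le> exp (- ?g) ^ s"
    using spectral_gap_le_1 exp_ge_add_one_self[of "- ?g"] by (intro power_mono) auto
  moreover have "exp (- ?g) ^ s = exp (- (?g * s))" by (simp add: exp_of_nat_mult[symmetric] mult.commute)
  ultimately have "(1 - ?g) ^ s / ?c \<le> \<epsilon> / (2 * vol P)" using c0 by (simp add: field_simps)
  hence "col_sum P i * ((1 - ?g) ^ s / ?c) \<le> col_sum P i * (\<epsilon> / (2 * vol P))"
    using col_sum_pos[OF i] by (intro mult_left_mono) auto
  moreover have "(push ^^ s) x i \<ge> col_sum P i / (\<Sum>j<k. col_sum P j) - col_sum P i * (1 - ?g) ^ s / ?c"
    by (rule push_iterate_ge)
       (use averaging_norm_le[OF averaging_eigenvalue_le] spectral_gap_le_1 x c0 i mono in auto)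
  moreover have "(1 - \<epsilon> / 2) * stationary P i
      = col_sum P i / (\<Sum>j<k. col_sum P j) - col_sum P i * (\<epsilon> / (2 * vol P))"
    using vol_pos by (simp add: stationary_def vol_def field_simps)
  ultimately show ?thesis by simp
qed

end

section \<open>Paths through typical neighbours\<close>

lemma length_vwalk_to_vpath_le: "length (vwalk_to_vpath p) \<le> length p"
proof (induction p rule: vwalk_to_vpath_induct3)
  case (in_set x xs)
  thus ?case using length_dropWhile_le[of "\<lambda>y. y \<noteq> x" xs] by simp
qed auto

text \<open>Following neighbours may revisit vertices and yields a walk; cutting out its cycles
  keeps the endpoints and does not lengthen it. \<open>Suc n\<close> appears because a walk is
  stored as its list of vertices.\<close>

lemma linked_withinI:
  assumes "vwalk p G" "hd p = v" "last p \<in> S" "length p \<le> Suc n"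
  shows "linked_within G v S n"
  unfolding linked_within_def
  using assms length_vwalk_to_vpath_le[of p]
  by (intro exI[of _ "vwalk_to_vpath p"])
     (auto simp: vwalk_to_vpath_vpath vwalk_to_vpath_hd vwalk_to_vpath_last)

lemma vwalk_snoc:
  assumes "vwalk p G" "w \<in> verts G" "(last p, w) \<in> arcs_ends G"
  shows "vwalk (p @ [w]) G"
  using assms set_vwalk_arcs_snoc[of p w] unfolding vwalk_def by auto

lemma kronecker_graph_support:
  assumes "G \<in> set_pmf (kronecker_graph P t)"
  shows "pverts G = kron_verts (dim_row P) t"
  using assms by (auto simp: kronecker_graph_def)

text \<open>The path consisting of \<open>v\<close> alone works for every \<open>s\<close>, in
  particular for \<open>s = 0\<close>, as the degenerate cases require.\<close>

lemma kronecker_graph_linked_refl: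
  assumes "v \<in> balanced_verts P t \<epsilon>"
  shows "measure_pmf.prob (kronecker_graph P t)
     {G. linked_within (with_proj G) v (balanced_verts P t \<epsilon>) s} = 1"
proof -
  have "linked_within (with_proj G) v (balanced_verts P t \<epsilon>) s"
    if "G \<in> set_pmf (kronecker_graph P t)" for G
    using assms kronecker_graph_support[OF that]
    by (intro linked_withinI[of "[v]"]) (auto simp: balanced_verts_def vwalk_def)
  thus ?thesis by (simp add: measure_pmf.prob_eq_1 AE_measure_pmf_iff)
qed

context kronecker_generator
begin

abbreviation counts :: "nat list \<Rightarrow> nat \<Rightarrow> real" where
  "counts u \<equiv> \<lambda>l. real (count_list u l)"

text \<open>At \<open>counts u\<close> this is the logarithm of the total weight at
  \<open>u\<close>, with the product for \<open>u\<close> against itself included. Counts replace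
  proportions, which removes the factor \<open>t\<close>.\<close>

definition log_degree :: "(nat \<Rightarrow> real) \<Rightarrow> real" where
  "log_degree x = (\<Sum>l<k. x l * ln (col_sum P l))"

text \<open>A deterministic set of candidates, adjacent to \<open>u\<close> or not;
  \<open>push (counts u)\<close> is the expected count vector of a random neighbour.\<close>

definition typical_nbrs :: "nat \<Rightarrow> nat list \<Rightarrow> nat list set" where
  "typical_nbrs t u = {w \<in> kron_verts k t. \<forall>j<k.
     \<bar>counts w j - push (counts u) j\<bar> \<le> sqrt (2 * real k * real t)}"

lemma prod_col_sum:
  assumes u: "u \<in> kron_verts k t"
  shows "(\<Prod>i<t. col_sum P (u ! i)) = exp (log_degree (counts u))"
proof -
  have "(\<Prod>i<t. col_sum P (u ! i)) = (\<Prod>i<t. exp (ln (col_sum P (u ! i))))"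
    using kron_verts_nth[OF u] by (intro prod.cong) (auto simp: col_sum_pos)
  also have "\<dots> = exp (\<Sum>i<t. ln (col_sum P (u ! i)))" by (simp add: exp_sum)
  also have "(\<Sum>i<t. ln (col_sum P (u ! i))) = log_degree (counts u)"
    unfolding log_degree_def using u
    by (subst sum_nth_eq_sum_count_list[of u k "\<lambda>l. ln (col_sum P l)", symmetric])
       (auto simp: kron_verts_def)
  finally show ?thesis .
qed

text \<open>An edge probability factors into the total weight at \<open>u\<close> and the
  probability of \<open>t\<close> independent walk steps, and typical vertices carry half of the
  latter. The 1 pays for \<open>u\<close> itself, which may be typical.\<close>

lemma typical_nbrs_weight:
  assumes t: "0 < t" and u: "u \<in> kron_verts k t"
  shows "(\<Sum>w\<in>typical_nbrs t u - {u}. pair_prob P t {u, w}) \<ge> exp (log_degree (counts u)) / 2 - 1"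
proof -
  define M where "M = (\<lambda>i j. P $$ (i, j) / col_sum P i)"
  have M0: "0 \<le> M i j" if "i < k" "j < k" for i j
    using P_nonneg col_sum_pos[of i] that by (simp add: M_def)
  have M1: "(\<Sum>j<k. M i j) = 1" if "i < k" for i
    using c_eq[OF that] col_sum_pos[OF that] by (simp add: M_def flip: sum_divide_distrib)
  have len: "length u = t" "set u \<subseteq> {0..<k}" using u by (auto simp: kron_verts_def)
  have "(\<Sum>i<t. M (u ! i) j) = push (counts u) j" for j
    using sum_nth_eq_sum_count_list[OF len(2), of "\<lambda>l. M l j"] len(1)
    by (simp add: push_def M_def)
  hence tn: "typical_nbrs t u = {w \<in> kron_verts k t. \<forall>j<k.
      \<bar>real (count_list w j) - (\<Sum>i<t. M (u ! i) j)\<bar> \<le> sqrt (2 * real k * real t)}"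
    by (simp add: typical_nbrs_def)
  have fin: "finite (typical_nbrs t u)" by (simp add: typical_nbrs_def finite_kron_verts)
  have half: "1 / 2 \<le> (\<Sum>w\<in>typical_nbrs t u. \<Prod>i<t. M (u ! i) (w ! i))"
    unfolding tn using typical_neighbours_weight[of k M, OF M0 M1 _ t u] k2 by simp
  have pp: "pair_prob P t {u, w} = exp (log_degree (counts u)) * (\<Prod>i<t. M (u ! i) (w ! i))"
    if "w \<in> typical_nbrs t u" for w
  proof -
    have w: "w \<in> kron_verts k t" using that by (simp add: typical_nbrs_def)
    have "pair_prob P t {u, w} = (\<Prod>i<t. col_sum P (u ! i) * M (u ! i) (w ! i))"
      unfolding pair_prob_eq[OF P_carrier P_sym u w]
      using col_sum_pos[OF kron_verts_nth[OF u]] by (intro prod.cong refl) (force simp: M_def)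
    thus ?thesis by (simp add: prod.distrib prod_col_sum[OF u])
  qed
  have "exp (log_degree (counts u)) / 2
      \<le> exp (log_degree (counts u)) * (\<Sum>w\<in>typical_nbrs t u. \<Prod>i<t. M (u ! i) (w ! i))"
    using mult_left_mono[OF half, of "exp (log_degree (counts u))"] by simp
  also have "\<dots> = (\<Sum>w\<in>typical_nbrs t u. pair_prob P t {u, w})"
    by (simp add: pp sum_distrib_left)
  also have "\<dots> \<le> (\<Sum>w\<in>typical_nbrs t u - {u}. pair_prob P t {u, w}) + 1"
    using fin pair_prob_bounds(2)[OF P_carrier P_sym P01 u u]
    by (cases "u \<in> typical_nbrs t u") (auto simp: sum_diff1)
  finally show ?thesis by simp
qed

text \<open>Apart from the vertex set, all that the path construction asks of the random graph.
  Since it holds for all vertices of large degree at once, the next vertex of the path may depend on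
  the graph.\<close>

definition expands :: "nat \<Rightarrow> real \<Rightarrow> nat list pair_pre_digraph \<Rightarrow> bool" where
  "expands t D G \<longleftrightarrow> (\<forall>u\<in>kron_verts k t. D \<le> log_degree (counts u) \<longrightarrow>
     (\<exists>w\<in>typical_nbrs t u. (u, w) \<in> parcs G))"

text \<open>The failure probability at one vertex is doubly exponentially small, so a union bound
  over all \<open>k\<^sup>t\<close> vertices is affordable and no independence between the steps of the path is
  needed.\<close>

lemma prob_not_expands:
  assumes t: "0 < t"
  shows "measure_pmf.prob (kronecker_graph P t) {G. \<not> expands t D G}
      \<le> real k ^ t * exp (1 - exp D / 2)"
proof -
  let ?p = "measure_pmf.prob (kronecker_graph P t)"
  let ?U = "{u \<in> kron_verts k t. D \<le> log_degree (counts u)}"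
  let ?F = "\<lambda>u. {G. \<forall>w\<in>typical_nbrs t u - {u}. (u, w) \<notin> parcs G}"
  have "?p {G. \<not> expands t D G} \<le> ?p (\<Union>u\<in>?U. ?F u)"
    by (rule measure_pmf.finite_measure_mono) (auto simp: expands_def)
  also have "\<dots> \<le> (\<Sum>u\<in>?U. ?p (?F u))"
    by (rule measure_pmf.finite_measure_subadditive_finite) (auto simp: finite_kron_verts)
  also have "\<dots> \<le> (\<Sum>u\<in>?U. exp (1 - exp D / 2))"
  proof (rule sum_mono)
    fix u assume "u \<in> ?U"
    hence u: "u \<in> kron_verts k t" and D: "D \<le> log_degree (counts u)" by auto
    have "?p (?F u) \<le> exp (- (\<Sum>w\<in>typical_nbrs t u - {u}. pair_prob P t {u, w}))"
      by (rule prob_no_neighbour_le[OF P_carrier P_sym P01 u]) (auto simp: typical_nbrs_def)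
    also have "\<dots> \<le> exp (1 - exp D / 2)"
    proof -
      have "exp D \<le> exp (log_degree (counts u))" using D by simp
      hence "- (\<Sum>w\<in>typical_nbrs t u - {u}. pair_prob P t {u, w}) \<le> 1 - exp D / 2"
        using typical_nbrs_weight[OF t u] by linarith
      thus ?thesis by simp
    qed
    finally show "?p (?F u) \<le> exp (1 - exp D / 2)" .
  qed
  also have "\<dots> = real (card ?U) * exp (1 - exp D / 2)" by simp
  also have "\<dots> \<le> real k ^ t * exp (1 - exp D / 2)"
  proof (rule mult_right_mono)
    have "card ?U \<le> card (kron_verts k t)" by (rule card_mono[OF finite_kron_verts]) auto
    thus "real (card ?U) \<le> real k ^ t" unfolding card_kron_verts by (metis of_nat_le_iff of_nat_power)
  qed simp
  finally show ?thesis .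
qed

text \<open>The rows of the transition matrix are nonnegative and sum to 1, so the l1 distance does
  not grow and the errors of successive steps merely add up.\<close>

lemma push_contraction: "(\<Sum>j<k. \<bar>push x j - push y j\<bar>) \<le> (\<Sum>i<k. \<bar>x i - y i\<bar>)"
proof -
  have "\<bar>push x j - push y j\<bar> \<le> (\<Sum>i<k. \<bar>x i - y i\<bar> * (P $$ (i, j) / col_sum P i))" if j: "j < k" for j
  proof -
    have "push x j - push y j = (\<Sum>i<k. (x i - y i) * (P $$ (i, j) / col_sum P i))"
      by (simp add: push_def left_diff_distrib sum_subtractf diff_divide_distrib)
    also have "\<bar>\<dots>\<bar> \<le> (\<Sum>i<k. \<bar>(x i - y i) * (P $$ (i, j) / col_sum P i)\<bar>)" by (rule sum_abs)
    also have "\<dots> = (\<Sum>i<k. \<bar>x i - y i\<bar> * (P $$ (i, j) / col_sum P i))"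
      using P_nonneg j col_sum_pos by (intro sum.cong refl) (auto simp: abs_mult less_imp_le)
    finally show ?thesis .
  qed
  hence "(\<Sum>j<k. \<bar>push x j - push y j\<bar>)
      \<le> (\<Sum>j<k. \<Sum>i<k. \<bar>x i - y i\<bar> * (P $$ (i, j) / col_sum P i))"
    by (intro sum_mono) simp
  also have "\<dots> = (\<Sum>i<k. \<bar>x i - y i\<bar> * ((\<Sum>j<k. P $$ (i, j)) / col_sum P i))"
    by (subst sum.swap) (simp add: sum_distrib_left sum_divide_distrib)
  also have "\<dots> = (\<Sum>i<k. \<bar>x i - y i\<bar>)"
    using c_eq col_sum_pos by (intro sum.cong refl) fastforce
  finally show ?thesis .
qed

lemma push_divide: "push (\<lambda>i. x i / a) j = push x j / a"
  unfolding push_def sum_divide_distrib by (intro sum.cong refl) (simp add: mult.commute)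

lemma push_iterate_divide: "(push ^^ n) (\<lambda>i. x i / a) j = (push ^^ n) x j / a"
proof (induction n arbitrary: j)
  case (Suc n)
  have "(push ^^ n) (\<lambda>i. x i / a) = (\<lambda>j. (push ^^ n) x j / a)" by (rule ext) (rule Suc.IH)
  thus ?case by (simp add: push_divide)
qed simp

lemma walk_matrix_carrier: "walk_matrix P \<in> carrier_mat k k"
  by (auto simp: walk_matrix_def mat_diag_def)

lemma walk_matrix_index: "i < k \<Longrightarrow> j < k \<Longrightarrow> walk_matrix P $$ (i, j) = P $$ (i, j) / col_sum P i"
  using P_carrier by (simp add: walk_matrix_def mat_diag_mult_left[of _ k k])

lemma transpose_walk_matrix_power:
  assumes v: "v \<in> kron_verts k t"
  shows "j < k \<Longrightarrow> vec_index (transpose_mat (walk_matrix P ^\<^sub>m n) *\<^sub>v signature k v) j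
      = (push ^^ n) (counts v) j / t"
proof (induction n arbitrary: j)
  case 0
  have sg: "signature k v \<in> carrier_vec k" by (simp add: signature_def)
  have "dim_row (walk_matrix P) = k" using walk_matrix_carrier by auto
  hence "transpose_mat (walk_matrix P ^\<^sub>m 0) *\<^sub>v signature k v = signature k v"
    using sg by (simp add: transpose_one)
  thus ?case using 0 v by (simp add: signature_def kron_verts_def)
next
  case (Suc n)
  let ?M = "walk_matrix P"
  note M = walk_matrix_carrier
  have sg: "signature k v \<in> carrier_vec k" by (simp add: signature_def)
  have Mn: "?M ^\<^sub>m n \<in> carrier_mat k k" using M by simp
  let ?y = "transpose_mat (?M ^\<^sub>m n) *\<^sub>v signature k v"
  have y: "?y \<in> carrier_vec k" using Mn sg by auto
  have "transpose_mat (?M ^\<^sub>m Suc n) *\<^sub>v signature k v = transpose_mat ?M *\<^sub>v ?y"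
    using M Mn sg by (simp add: transpose_mult[OF Mn M] assoc_mult_mat_vec[of _ k k _ k])
  hence "vec_index (transpose_mat (?M ^\<^sub>m Suc n) *\<^sub>v signature k v) j
      = (\<Sum>i<k. ?M $$ (i, j) * vec_index ?y i)"
    using M y Suc.prems by (simp add: scalar_prod_def lessThan_atLeast0 del: index_mult_mat_vec) (simp add: scalar_prod_def)
  also have "\<dots> = (\<Sum>i<k. (push ^^ n) (counts v) i / t * (P $$ (i, j) / col_sum P i))"
    using Suc.prems by (intro sum.cong refl) (simp add: Suc.IH walk_matrix_index mult.commute)
  also have "\<dots> = (push ^^ Suc n) (counts v) j / t"
    by (simp only: push_def[of "\<lambda>i. (push ^^ n) (counts v) i / t" j, symmetric] push_divide) simp
  finally show ?case .
qed

lemma expanding_verts_log_degree: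
  assumes v: "v \<in> expanding_verts P t \<nu>" and t: "0 < t"
  shows "\<nu> * t \<le> log_degree ((push ^^ n) (counts v))"
proof -
  let ?y = "transpose_mat (walk_matrix P ^\<^sub>m n) *\<^sub>v signature k v"
  have vk: "v \<in> kron_verts k t" and "\<nu> \<le> ?y \<bullet> log_vec P"
    using v by (auto simp: expanding_verts_def)
  moreover have "?y \<bullet> log_vec P = (\<Sum>l<k. vec_index ?y l * ln (col_sum P l))"
    by (simp add: scalar_prod_def log_vec_def lessThan_atLeast0 del: index_mult_mat_vec)
  moreover have "\<dots> = log_degree ((push ^^ n) (counts v)) / t"
    unfolding log_degree_def sum_divide_distrib
    by (intro sum.cong refl) (simp add: transpose_walk_matrix_power[OF vk] del: index_mult_mat_vec)
  ultimately show ?thesis using t by (simp add: pos_le_divide_eq)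
qed

lemma log_degree_ge:
  assumes "(\<Sum>l<k. \<bar>x l - y l\<bar>) \<le> d"
  shows "log_degree x \<ge> log_degree y - d * (\<Sum>l<k. \<bar>ln (col_sum P l)\<bar>)"
proof -
  let ?\<Lambda> = "\<Sum>l<k. \<bar>ln (col_sum P l)\<bar>"
  have "log_degree y - log_degree x = (\<Sum>l<k. (y l - x l) * ln (col_sum P l))"
    by (simp add: log_degree_def sum_subtractf left_diff_distrib)
  also have "\<dots> \<le> (\<Sum>l<k. \<bar>x l - y l\<bar> * ?\<Lambda>)"
  proof (rule sum_mono)
    fix l assume l: "l \<in> {..<k}"
    have "(y l - x l) * ln (col_sum P l) \<le> \<bar>x l - y l\<bar> * \<bar>ln (col_sum P l)\<bar>"
      by (metis abs_ge_self abs_minus_commute abs_mult)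
    also have "\<dots> \<le> \<bar>x l - y l\<bar> * ?\<Lambda>"
      using l by (intro mult_left_mono member_le_sum) auto
    finally show "(y l - x l) * ln (col_sum P l) \<le> \<bar>x l - y l\<bar> * ?\<Lambda>" .
  qed
  also have "\<dots> \<le> d * ?\<Lambda>"
    unfolding sum_distrib_right[symmetric] using assms by (intro mult_right_mono) (auto intro: sum_nonneg)
  finally show ?thesis by simp
qed

text \<open>Each step adds at most one Chebyshev threshold per letter to the l1 distance from the
  exact walk. The bound on \<open>D\<close> allows for the error of all \<open>s\<close> steps, so
  every vertex on the way still has a large enough degree.\<close>

lemma expands_walk:
  assumes t: "0 < t" and v: "v \<in> expanding_verts P t \<nu>"
    and G: "pverts G = kron_verts k t"
    and D: "D \<le> \<nu> * t - s * k * sqrt (2 * real k * real t) * (\<Sum>l<k. \<bar>ln (col_sum P l)\<bar>)"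
    and ex: "expands t D G"
    and n: "n \<le> s"
  shows "\<exists>p. vwalk p (with_proj G) \<and> hd p = v \<and> length p = Suc n \<and>
    (\<Sum>j<k. \<bar>counts (last p) j - (push ^^ n) (counts v) j\<bar>) \<le> n * k * sqrt (2 * real k * real t)"
  using n
proof (induction n)
  case 0
  have "v \<in> kron_verts k t" using v by (simp add: expanding_verts_def)
  thus ?case using G by (intro exI[of _ "[v]"]) (auto simp: vwalk_def)
next
  case (Suc n)
  let ?a = "sqrt (2 * real k * real t)" and ?\<Lambda> = "\<Sum>l<k. \<bar>ln (col_sum P l)\<bar>"
  from Suc obtain p where p: "vwalk p (with_proj G)" "hd p = v" "length p = Suc n"
    and dev: "(\<Sum>j<k. \<bar>counts (last p) j - (push ^^ n) (counts v) j\<bar>) \<le> n * k * ?a" by auto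
  have pne: "p \<noteq> []" using p(3) by auto
  have u: "last p \<in> kron_verts k t" using p(1) pne G last_in_set[OF pne] by (auto simp: vwalk_def)
  have "real (n * k) * ?a * ?\<Lambda> \<le> real (s * k) * ?a * ?\<Lambda>"
    using Suc.prems by (intro mult_right_mono) (auto intro: sum_nonneg mult_right_mono)
  hence "D \<le> log_degree (counts (last p))"
    using log_degree_ge[OF dev] expanding_verts_log_degree[OF v t, of n] D by linarith
  with ex u obtain w where w: "w \<in> typical_nbrs t (last p)" and arc: "(last p, w) \<in> parcs G"
    by (auto simp: expands_def)
  have wV: "w \<in> kron_verts k t" using w by (simp add: typical_nbrs_def)
  have "vwalk (p @ [w]) (with_proj G)"
    by (rule vwalk_snoc[OF p(1)]) (use wV G arc in \<open>auto simp: arcs_ends_def arc_to_ends_def\<close>)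
  moreover have "(\<Sum>j<k. \<bar>counts w j - (push ^^ Suc n) (counts v) j\<bar>) \<le> Suc n * k * ?a"
  proof -
    have "(\<Sum>j<k. \<bar>counts w j - (push ^^ Suc n) (counts v) j\<bar>)
        \<le> (\<Sum>j<k. \<bar>counts w j - push (counts (last p)) j\<bar>
             + \<bar>push (counts (last p)) j - push ((push ^^ n) (counts v)) j\<bar>)"
      by (intro sum_mono) simp
    also have "\<dots> \<le> (\<Sum>j<k. ?a) + n * k * ?a"
      unfolding sum.distrib
      by (intro add_mono sum_mono order.trans[OF push_contraction dev])
         (use w in \<open>auto simp: typical_nbrs_def\<close>)
    finally show ?thesis by (simp add: algebra_simps)
  qed
  ultimately show ?case using p pne by (intro exI[of _ "p @ [w]"]) auto
qed

text \<open>Mixing costs one half of \<epsilon>. The hypothesis \<open>large\<close> keeps the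
  accumulated sampling error below the other half, measured at letter 0, whose stationary weight is
  the smallest.\<close>

lemma expands_linked:
  assumes t: "0 < t" and v: "v \<in> expanding_verts P t \<nu>"
    and G: "pverts G = kron_verts k t"
    and D: "D \<le> \<nu> * t - s * k * sqrt (2 * real k * real t) * (\<Sum>l<k. \<bar>ln (col_sum P l)\<bar>)"
    and ex: "expands t D G"
    and mono: "\<forall>i j. i \<le> j \<longrightarrow> j < k \<longrightarrow> col_sum P i \<le> col_sum P j"
    and e: "0 < \<epsilon>" and s: "s \<ge> 1 / spectral_gap P * ln (2 * vol P / (col_sum P 0 * \<epsilon>))"
    and large: "s * k * sqrt (2 * real k * real t) < \<epsilon> / 2 * stationary P 0 * t"
  shows "linked_within (with_proj G) v (balanced_verts P t \<epsilon>) s"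
proof -
  let ?a = "sqrt (2 * real k * real t)"
  from expands_walk[OF t v G D ex order.refl] obtain p
    where p: "vwalk p (with_proj G)" "hd p = v" "length p = Suc s"
      and dev: "(\<Sum>j<k. \<bar>counts (last p) j - (push ^^ s) (counts v) j\<bar>) \<le> s * k * ?a" by blast
  have pne: "p \<noteq> []" using p(3) by auto
  have u: "last p \<in> kron_verts k t" using p(1) pne G last_in_set[OF pne] by (auto simp: vwalk_def)
  have vk: "v \<in> kron_verts k t" using v by (simp add: expanding_verts_def)
  have sum1: "(\<Sum>i<k. counts v i / t) = 1"
    using sum_nth_eq_sum_count_list[of v k "\<lambda>_. 1"] vk t
    by (simp add: kron_verts_def flip: sum_divide_distrib)
  have "vec_index (signature k (last p)) i > (1 - \<epsilon>) * stationary P i" if i: "i < k" for i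
  proof -
    have "(1 - \<epsilon> / 2) * stationary P i \<le> (push ^^ s) (\<lambda>i. counts v i / t) i"
      by (rule push_iterate_mixing[OF _ sum1 mono e s i]) simp
    hence 1: "(1 - \<epsilon> / 2) * stationary P i * t \<le> (push ^^ s) (counts v) i"
      using t by (simp add: push_iterate_divide pos_le_divide_eq)
    have "\<bar>counts (last p) i - (push ^^ s) (counts v) i\<bar>
        \<le> (\<Sum>j<k. \<bar>counts (last p) j - (push ^^ s) (counts v) j\<bar>)"
      using i by (intro member_le_sum) auto
    hence 2: "counts (last p) i \<ge> (push ^^ s) (counts v) i - s * k * ?a" using dev by linarith
    have "stationary P 0 \<le> stationary P i"
      unfolding stationary_def using mono i vol_pos by (intro divide_right_mono) auto
    hence "\<epsilon> / 2 * stationary P 0 * t \<le> \<epsilon> / 2 * stationary P i * t"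
      using e by (intro mult_right_mono mult_left_mono) auto
    with 1 2 large have "counts (last p) i > (1 - \<epsilon> / 2) * stationary P i * t - \<epsilon> / 2 * stationary P i * t"
      by linarith
    also have "(1 - \<epsilon> / 2) * stationary P i * t - \<epsilon> / 2 * stationary P i * t = (1 - \<epsilon>) * stationary P i * t"
      by (simp add: algebra_simps)
    finally show ?thesis using t i u by (simp add: signature_def kron_verts_def pos_less_divide_eq)
  qed
  hence "last p \<in> balanced_verts P t \<epsilon>" using u by (simp add: balanced_verts_def)
  thus ?thesis using p by (intro linked_withinI) auto
qed

end

section \<open>Asymptotics, degenerate cases and conclusion\<close>

lemma eventually_doubly_exponential_bound:
  fixes k :: nat and \<nu> C :: real
  assumes k: "0 < k" and \<nu>: "0 < \<nu>"
  shows "\<forall>\<^sub>F t in sequentially. real k ^ t * exp (1 - exp (\<nu> * real t - C * sqrt (real t)) / 2)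
     \<le> exp (- exp (\<nu> * real t - (C + 1) * sqrt (real t)))"
proof -
  \<comment> \<open>Raising \<open>C\<close> by 1 multiplies the inner exponential \<open>E\<close>
    by at most \<open>1 / 4\<close>. Of the available \<open>E / 2\<close> a quarter of
    \<open>E\<close> is then left over, which outgrows the logarithm of \<open>k ^ t\<close> and the
    constant 1.\<close>
  have 1: "\<forall>\<^sub>F t in sequentially. exp (- sqrt (real t)) \<le> 1 / 4" by real_asymp
  have 2: "\<forall>\<^sub>F t in sequentially. C * sqrt (real t) \<le> \<nu> / 2 * real t"
    using \<nu> by real_asymp
  have 3: "\<forall>\<^sub>F t in sequentially. real t * ln (real k) + 1 \<le> exp (\<nu> / 2 * real t) / 4"
    using \<nu> by real_asymp
  show ?thesis using 1 2 3
  proof eventually_elim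
    case (elim t)
    define E where "E = exp (\<nu> * real t - C * sqrt (real t))"
    have "exp (\<nu> / 2 * real t) \<le> E" unfolding E_def using elim(2) by simp
    moreover have "exp (\<nu> * real t - (C + 1) * sqrt (real t)) = E * exp (- sqrt (real t))"
      by (simp add: E_def algebra_simps flip: exp_add)
    moreover have "E * exp (- sqrt (real t)) \<le> E * (1 / 4)"
      using elim(1) by (intro mult_left_mono) (auto simp: E_def)
    ultimately have "real t * ln (real k) + (1 - E / 2) \<le> - exp (\<nu> * real t - (C + 1) * sqrt (real t))"
      using elim(3) by linarith
    moreover have "real k ^ t = exp (real t * ln (real k))"
      using k by (simp add: exp_of_nat_mult)
    ultimately show ?case by (simp add: E_def flip: exp_add)
  qed
qed

text \<open>For \<open>k = 0\<close> there is no vertex of positive length, and for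
  \<open>k = 1\<close> the only signature is the constant 1.\<close>

lemma one_vertex_balanced:
  assumes P: "P \<in> carrier_mat k k" and k: "k < 2" and t: "0 < t" and e: "0 < \<epsilon>"
    and v: "v \<in> kron_verts k t"
  shows "v \<in> balanced_verts P t \<epsilon>"
proof -
  have len: "length v = t" "set v \<subseteq> {0..<k}" using v by (auto simp: kron_verts_def)
  have "k \<noteq> 0" using kron_verts_nth[OF v t] by auto
  hence k1: "k = 1" using k by simp
  have "real (count_list v 0) = t"
    using sum_nth_eq_sum_count_list[OF len(2), of "\<lambda>_. 1"] len k1 by simp
  \<comment> \<open>The stationary weight is 1, or 0 by the convention for division if the single
    entry is 0; both give the strict inequality.\<close>
  moreover have "(1 - \<epsilon>) * stationary P 0 < 1"
    using P k1 e by (simp add: stationary_def vol_def)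
  ultimately show ?thesis
    using P v t len k1 by (simp add: balanced_verts_def signature_def)
qed

context kronecker_generator
begin

text \<open>Covers the range of \<epsilon> in which \<open>s\<close> can be 0: the required lower
  bounds on the signature are negative.\<close>

lemma large_epsilon_balanced:
  assumes v: "v \<in> kron_verts k t" and e: "1 < \<epsilon>"
  shows "v \<in> balanced_verts P t \<epsilon>"
proof -
  have "(1 - \<epsilon>) * stationary P i < 0" if "i < k" for i
    using e col_sum_pos[OF that] vol_pos by (intro mult_neg_pos) (auto simp: stationary_def)
  thus ?thesis using v by (force simp: balanced_verts_def signature_def intro: less_le_trans)
qed

text \<open>Guarantees \<open>s \<ge> 1\<close>, so that multiplying the failure probability by
  \<open>s\<close> only weakens the bound. The smallest column sum is at most the volume, so the
  logarithm has an argument above 1.\<close>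

lemma steps_pos:
  assumes "0 < \<epsilon>" "\<epsilon> \<le> 1"
  shows "0 < 1 / spectral_gap P * ln (2 * vol P / (col_sum P 0 * \<epsilon>))"
proof -
  have c: "0 < col_sum P 0" using col_sum_pos k2 by simp
  have "col_sum P 0 \<le> vol P"
    unfolding vol_def using k2 col_sum_pos by (intro member_le_sum) (auto simp: less_imp_le)
  moreover have "col_sum P 0 * \<epsilon> \<le> col_sum P 0 * 1" using assms c by (intro mult_left_mono) auto
  ultimately have "col_sum P 0 * \<epsilon> < 2 * vol P" using c by linarith
  hence "1 < 2 * vol P / (col_sum P 0 * \<epsilon>)" using c assms by (simp add: pos_less_divide_eq)
  thus ?thesis using spectral_gap_pos by simp
qed

lemma prob_linked_ge:
  assumes t: "0 < t" and v: "v \<in> expanding_verts P t \<nu>"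
    and mono: "\<forall>i j. i \<le> j \<longrightarrow> j < k \<longrightarrow> col_sum P i \<le> col_sum P j"
    and e: "0 < \<epsilon>" and s: "s \<ge> 1 / spectral_gap P * ln (2 * vol P / (col_sum P 0 * \<epsilon>))"
    and large: "s * k * sqrt (2 * real k * real t) < \<epsilon> / 2 * stationary P 0 * t"
    and D: "D \<le> \<nu> * t - s * k * sqrt (2 * real k * real t) * (\<Sum>l<k. \<bar>ln (col_sum P l)\<bar>)"
  shows "measure_pmf.prob (kronecker_graph P t)
      {G. linked_within (with_proj G) v (balanced_verts P t \<epsilon>) s}
    \<ge> 1 - real k ^ t * exp (1 - exp D / 2)"
proof -
  let ?p = "measure_pmf.prob (kronecker_graph P t)"
  have "1 - real k ^ t * exp (1 - exp D / 2) \<le> 1 - ?p {G. \<not> expands t D G}"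
    using prob_not_expands[OF t] by simp
  also have "\<dots> = ?p {G. expands t D G}"
    using measure_pmf.prob_compl[of "{G. expands t D G}" "kronecker_graph P t"]
    by (simp add: Compl_eq_Diff_UNIV[symmetric] Collect_neg_eq)
  also have "\<dots> \<le> ?p {G. linked_within (with_proj G) v (balanced_verts P t \<epsilon>) s}"
  proof (rule measure_pmf.finite_measure_mono_AE)
    \<comment> \<open>An almost sure inclusion, since the vertex set of \<open>G\<close> is known on
      the support of the measure only.\<close>
    show "AE G in measure_pmf (kronecker_graph P t). G \<in> {G. expands t D G} \<longrightarrow>
        G \<in> {G. linked_within (with_proj G) v (balanced_verts P t \<epsilon>) s}"
      unfolding AE_measure_pmf_iff
      using expands_linked[OF t v _ D _ mono e s large] kronecker_graph_support by auto
  qed simp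
  finally show ?thesis .
qed

end

theorem theorem10:
  fixes P :: "real mat" and k s :: nat and \<epsilon> \<nu> gap :: real
  assumes "P \<in> carrier_mat k k"
    and "\<forall>i<k. \<forall>j<k. 0 \<le> P $$ (i, j) \<and> P $$ (i, j) \<le> 1"
    and "transpose_mat P = P"
    and "\<forall>i j. i \<le> j \<longrightarrow> j < k \<longrightarrow> col_sum P i \<le> col_sum P j"
    and "Digraph_Component.connected (with_proj (weight_graph P))"
    and "\<not> bipartite (with_proj (weight_graph P))"
    and "\<epsilon> > 0" and "\<nu> > 0"
    and "gap = spectral_gap P"
    and "s = nat \<lceil>1 / gap * ln (2 * vol P / (col_sum P 0 * \<epsilon>))\<rceil>"
  shows "\<exists>f :: nat \<Rightarrow> real. (\<forall>t. 0 \<le> f t) \<and> f \<in> \<Theta>(\<lambda>t. sqrt (real t)) \<and>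
    (\<forall>\<^sub>F t in sequentially. \<forall>v \<in> expanding_verts P t \<nu>.
       measure_pmf.prob (kronecker_graph P t)
         {G. linked_within (with_proj G) v (balanced_verts P t \<epsilon>) s}
       \<ge> 1 - real s * exp (- exp (\<nu> * real t - f t)))"
proof (cases "k < 2")
  case True
  have "\<forall>\<^sub>F t in sequentially. \<forall>v \<in> expanding_verts P t \<nu>.
      measure_pmf.prob (kronecker_graph P t)
        {G. linked_within (with_proj G) v (balanced_verts P t \<epsilon>) s}
      \<ge> 1 - real s * exp (- exp (\<nu> * real t - sqrt (real t)))"
    using eventually_gt_at_top[of 0]
  proof eventually_elim
    case (elim t)
    have "v \<in> balanced_verts P t \<epsilon>" if "v \<in> expanding_verts P t \<nu>" for v
      using one_vertex_balanced[OF assms(1) True elim assms(7)] that assms(1)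
      by (auto simp: expanding_verts_def)
    thus ?case by (simp add: kronecker_graph_linked_refl)
  qed
  thus ?thesis by (intro exI[of _ "\<lambda>t. sqrt (real t)"]) auto
next
  case False
  interpret kronecker_generator P k
    using assms False by unfold_locales auto
  have k0: "0 < k" using False by simp
  \<comment> \<open>\<open>B * sqrt t\<close> is the l1 error accumulated in \<open>s\<close> steps
    and \<open>C * sqrt t\<close> the loss of logarithmic degree that it can cause. Both are the
    same for all \<open>v\<close>.\<close>
  define B where "B = real s * real k * sqrt (2 * real k)"
  define C where "C = B * (\<Sum>l<k. \<bar>ln (col_sum P l)\<bar>)"
  have C: "0 \<le> C" unfolding C_def B_def by (intro mult_nonneg_nonneg sum_nonneg) auto
  have st: "0 < stationary P 0" using col_sum_pos vol_pos k2 by (simp add: stationary_def)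
  have "\<forall>\<^sub>F t in sequentially. B * sqrt (real t) < \<epsilon> / 2 * stationary P 0 * real t"
  proof -
    have "0 < \<epsilon> / 2 * stationary P 0" using assms(7) st by simp
    thus ?thesis by real_asymp
  qed
  hence "\<forall>\<^sub>F t in sequentially. \<forall>v \<in> expanding_verts P t \<nu>.
      measure_pmf.prob (kronecker_graph P t)
        {G. linked_within (with_proj G) v (balanced_verts P t \<epsilon>) s}
      \<ge> 1 - real s * exp (- exp (\<nu> * real t - (C + 1) * sqrt (real t)))"
    using eventually_gt_at_top[of 0] eventually_doubly_exponential_bound[OF k0 assms(8), of C]
  proof eventually_elim
    case (elim t)
    show ?case
    proof
      fix v assume v: "v \<in> expanding_verts P t \<nu>"
      let ?p = "measure_pmf.prob (kronecker_graph P t)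
        {G. linked_within (with_proj G) v (balanced_verts P t \<epsilon>) s}"
      let ?x = "exp (- exp (\<nu> * real t - (C + 1) * sqrt (real t)))"
      show "?p \<ge> 1 - real s * ?x"
      proof (cases "1 < \<epsilon>")
        case True
        have "v \<in> kron_verts k t" using v by (simp add: expanding_verts_def)
        thus ?thesis using large_epsilon_balanced[OF _ True] by (simp add: kronecker_graph_linked_refl)
      next
        case False
        hence pos: "0 < 1 / gap * ln (2 * vol P / (col_sum P 0 * \<epsilon>))"
          unfolding assms(9) using assms(7) by (intro steps_pos) auto
        hence s1: "1 \<le> s" unfolding assms(10) by linarith
        have "real s \<ge> 1 / gap * ln (2 * vol P / (col_sum P 0 * \<epsilon>))"
          unfolding assms(10) by (rule real_nat_ceiling_ge)
        hence s: "real s \<ge> 1 / spectral_gap P * ln (2 * vol P / (col_sum P 0 * \<epsilon>))"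
          unfolding assms(9) .
        have Bt: "B * sqrt (real t) = real (s * k) * sqrt (2 * real k * real t)"
          by (simp add: B_def real_sqrt_mult)
        have "?p \<ge> 1 - real k ^ t * exp (1 - exp (\<nu> * real t - C * sqrt (real t)) / 2)"
        proof (rule prob_linked_ge[OF _ v assms(4) assms(7) s])
          show "real (s * k) * sqrt (2 * real k * real t) < \<epsilon> / 2 * stationary P 0 * real t"
            using elim(1) Bt by simp
          have "C * sqrt (real t) = B * sqrt (real t) * (\<Sum>l<k. \<bar>ln (col_sum P l)\<bar>)"
            by (simp add: C_def)
          thus "\<nu> * real t - C * sqrt (real t) \<le> \<nu> * real t
              - real (s * k) * sqrt (2 * real k * real t) * (\<Sum>l<k. \<bar>ln (col_sum P l)\<bar>)"
            unfolding Bt by simp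
        qed (use elim in simp)
        moreover have "?x \<le> real s * ?x" using s1 by simp
        ultimately show ?thesis using elim k2 by linarith
      qed
    qed
  qed
  \<comment> \<open>The summand 1 also keeps this function of exact order sqrt t when
    \<open>C\<close> is 0.\<close>
  moreover have "(\<lambda>t. (C + 1) * sqrt (real t)) \<in> \<Theta>(\<lambda>t. sqrt (real t))" using C by simp
  ultimately show ?thesis using C by (intro exI[of _ "\<lambda>t. (C + 1) * sqrt (real t)"]) auto
qed

end
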